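(* Let $A$ be an AH-algebra with diagonal maps. Then its mean dimension and its variation mean dimension agree: $\gamma(A)=\nu(A)$.
   Context: **Setting.** $A=\varinjlim(A_i,\varphi_i)$ is the inductive limit of a sequence of unital C*-algebras $A_i=\bigoplus_{l=1}^{h_i}A_{i,l}$, $A_{i,l}=p_{i,l}\mathrm{M}_{r_{i,l}}(\mathrm{C}(X_{i,l}))p_{i,l}$, with unital connecting maps $\varphi_{i,j}:A_i\to A_j$, where each $X_{i,l}$ is a connected compact Hausdorff space and $p_{i,l}$ is a projection of rank $n_{i,l}$; $\varphi_{i,j}^k:A_i\to A_{j,k}$ is the $k$-th component of $\varphi_{i,j}$. The connecting maps are diagonal: for all $i<j$ and all $l,k$ the component $A_{i,l}\to A_{j,k}$ of $\varphi_{i,j}$ has the form $f\mapsto\mathrm{diag}(f\circ\lambda_{i,j}^{l,k}(1),\dots,f\circ\lambda_{i,j}^{l,k}(m_{i,j}^{l,k}))$ for continuous maps $\lambda_{i,j}^{l,k}(m):X_{j,k}\to X_{i,l}$. For a finite open cover $\alpha$ of a space $X$ let $\mathrm{ord}(\alpha)=\max_{x\in X}\big(\sum_{U\in\alpha}1_U(x)\big)-1$ and $\mathcal D(\alpha)=\min\{\mathrm{ord}(\beta):\beta\text{ a finite open cover refining }\alpha\}$. Covers $\alpha\vee\beta$ consist of the sets $U\cap V$, $U\in\alpha$, $V\in\beta$. **Mean dimension.** Let $X_i=\bigsqcup_lX_{i,l}$. For a finite open cover $\alpha$ of $X_i$, each member of which is contained in a connected component, inducing covers $\alpha_l$ of $X_{i,l}$,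 put $\varphi_{i,j}^k(\alpha)=\bigvee_{l}\bigvee_{m}(\lambda_{i,j}^{l,k}(m))^{-1}(\alpha_l)$, an open cover of $X_{j,k}$. Set $\gamma_i(A)=\sup_{\alpha}\lim_{j\to\infty}\max_{1\le k\le h_j}\mathcal D(\varphi_{i,j}^k(\alpha))/n_{j,k}$ (the limit exists since the sequence is decreasing in $j$), and $\gamma(A)=\lim_i\gamma_i(A)$ (an increasing limit). **Variation mean dimension.** For a homogeneous algebra with base space $X$, a finite subset $\mathcal F$ of it and $\varepsilon>0$, let $\mathrm{Cov}(\mathcal F,\varepsilon)$ be the collection of finite open covers $\alpha$ of $X$ such that $\|f(x)-f(y)\|<\varepsilon$ for all $U\in\alpha$, $x,y\in U$, $f\in\mathcal F$, and $\mathcal D(\mathcal F,\varepsilon)=\min\{\mathrm{ord}(\alpha):\alpha\in\mathrm{Cov}(\mathcal F,\varepsilon)\}$. Put $\nu_i=\sup_{\mathcal F\subseteq A_i\text{ finite},\,\varepsilon>0}\liminf_{j\to\infty}\max_{1\le k\le h_j}\mathcal D(\varphi_{i,j}^k(\mathcal F),\varepsilon)/n_{j,k}$, and $\nu(A)=\lim_i\nu_i$ (an increasing limit). Both quantities are computed with respect to the same given decomposition. *)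

theory Defs
  imports
    "HOL-Analysis.Analysis"
    "Jordan_Normal_Form.DL_Rank"
    "Jordan_Normal_Form.Schur_Decomposition"
begin

section \<open>Open covers\<close>

definition fin_open_cover :: "'a topology \<Rightarrow> 'a set set \<Rightarrow> bool" where
  "fin_open_cover X \<alpha> \<longleftrightarrow> finite \<alpha> \<and> (\<forall>U\<in>\<alpha>. openin X U) \<and> \<Union>\<alpha> = topspace X"

definition refines :: "'a set set \<Rightarrow> 'a set set \<Rightarrow> bool" where
  "refines \<beta> \<alpha> \<longleftrightarrow> (\<forall>V\<in>\<beta>. \<exists>U\<in>\<alpha>. V \<subseteq> U)"

text \<open>The subtraction of natural numbers does not truncate here: the spaces below are nonempty, so the
  maximum is at least 1.\<close>

definition cover_ord :: "'a topology \<Rightarrow> 'a set set \<Rightarrow> nat" where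
  "cover_ord X \<alpha> = (MAX x\<in>topspace X. \<Sum>U\<in>\<alpha>. indicator U x) - 1"

text \<open>\<open>Inf\<close> of a nonempty set of natural numbers is its minimum.\<close>

definition cover_dim :: "'a topology \<Rightarrow> 'a set set \<Rightarrow> nat" where
  "cover_dim X \<alpha> = Inf {cover_ord X \<beta> |\<beta>. fin_open_cover X \<beta> \<and> refines \<beta> \<alpha>}"

text \<open>The join \<open>\<Or>\<^sub>i C i\<close> of a finite family of covers of \<open>Y\<close>: all intersections with one member taken
  from each \<open>C i\<close> (so \<open>{Y}\<close> for the empty family).\<close>

definition join_covers :: "'a set \<Rightarrow> 'i set \<Rightarrow> ('i \<Rightarrow> 'a set set) \<Rightarrow> 'a set set" where
  "join_covers Y I C = {Y \<inter> (\<Inter>i\<in>I. V i) |V. \<forall>i\<in>I. V i \<in> C i}"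

definition pullback_cover :: "'b topology \<Rightarrow> ('b \<Rightarrow> 'a) \<Rightarrow> 'a set set \<Rightarrow> 'b set set" where
  "pullback_cover Y f \<alpha> = (\<lambda>U. {y \<in> topspace Y. f y \<in> U}) ` \<alpha>"


section \<open>Direct sums of homogeneous algebras\<close>

definition vec_l2norm :: "complex vec \<Rightarrow> real" where
  "vec_l2norm v = sqrt (\<Sum>s<dim_vec v. (cmod (vec_index v s))\<^sup>2)"

definition mat_opnorm :: "complex mat \<Rightarrow> real" where
  "mat_opnorm B = Sup {vec_l2norm (B *\<^sub>v v) |v. v \<in> carrier_vec (dim_col B) \<and> vec_l2norm v \<le> 1}"

text \<open>The data of \<open>\<Oplus>\<^sub>l p\<^sub>l M\<^bsub>r\<^sub>l\<^esub>(C(X\<^sub>l)) p\<^sub>l\<close>, \<open>l < h\<close>, with \<open>n\<^sub>l\<close> the rank of \<open>p\<^sub>l\<close>.\<close>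

record 'a homog_sum =
  num :: nat                               \<comment> \<open>\<open>h\<close>\<close>
  base :: "nat \<Rightarrow> 'a topology"              \<comment> \<open>\<open>X\<^sub>l\<close>\<close>
  msize :: "nat \<Rightarrow> nat"                     \<comment> \<open>\<open>r\<^sub>l\<close>\<close>
  proj :: "nat \<Rightarrow> 'a \<Rightarrow> complex mat"         \<comment> \<open>\<open>p\<^sub>l\<close>\<close>
  prank :: "nat \<Rightarrow> nat"                     \<comment> \<open>\<open>n\<^sub>l\<close>\<close>

type_synonym 'a elem = "nat \<Rightarrow> 'a \<Rightarrow> complex mat"

definition mat_continuous :: "'a topology \<Rightarrow> nat \<Rightarrow> ('a \<Rightarrow> complex mat) \<Rightarrow> bool" where
  "mat_continuous X r f \<longleftrightarrow>
     (\<forall>x\<in>topspace X. f x \<in> carrier_mat r r) \<and>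
     (\<forall>s<r. \<forall>t<r. continuous_map X euclidean (\<lambda>x. f x $$ (s, t)))"

definition homog_sum :: "'a homog_sum \<Rightarrow> bool" where
  "homog_sum B \<longleftrightarrow> 0 < num B \<and>
     (\<forall>l<num B.
        topspace (base B l) \<noteq> {} \<and> connected_space (base B l) \<and>
        compact_space (base B l) \<and> Hausdorff_space (base B l) \<and>
        0 < prank B l \<and> mat_continuous (base B l) (msize B l) (proj B l) \<and>
        (\<forall>x\<in>topspace (base B l).
           proj B l x * proj B l x = proj B l x \<and>
           mat_adjoint (proj B l x) = proj B l x \<and>
           vec_space.rank (msize B l) (proj B l x) = prank B l))"

text \<open>Functions are extensional on the base spaces and on the index set of the summands, so that equality
  in HOL is equality in the algebra.\<close>

definition summand :: "'a homog_sum \<Rightarrow> nat \<Rightarrow> ('a \<Rightarrow> complex mat) set" where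
  "summand B l = {f \<in> extensional (topspace (base B l)).
     mat_continuous (base B l) (msize B l) f \<and>
     (\<forall>x\<in>topspace (base B l). proj B l x * f x * proj B l x = f x)}"

definition alg :: "'a homog_sum \<Rightarrow> 'a elem set" where
  "alg B = (\<Pi>\<^sub>E l\<in>{..<num B}. summand B l)"

definition pointwise1 :: "'a homog_sum \<Rightarrow> (complex mat \<Rightarrow> complex mat) \<Rightarrow> 'a elem \<Rightarrow> 'a elem" where
  "pointwise1 B u f = (\<lambda>l\<in>{..<num B}. \<lambda>x\<in>topspace (base B l). u (f l x))"

definition pointwise2 ::
    "'a homog_sum \<Rightarrow> (complex mat \<Rightarrow> complex mat \<Rightarrow> complex mat) \<Rightarrow> 'a elem \<Rightarrow> 'a elem \<Rightarrow> 'a elem" where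
  "pointwise2 B u f g = (\<lambda>l\<in>{..<num B}. \<lambda>x\<in>topspace (base B l). u (f l x) (g l x))"

definition alg_unit :: "'a homog_sum \<Rightarrow> 'a elem" where
  "alg_unit B = pointwise1 B (\<lambda>b. b) (proj B)"

definition unital_star_hom :: "'a homog_sum \<Rightarrow> 'a homog_sum \<Rightarrow> ('a elem \<Rightarrow> 'a elem) \<Rightarrow> bool" where
  "unital_star_hom B C \<psi> \<longleftrightarrow>
     \<psi> \<in> alg B \<rightarrow> alg C \<and>
     \<psi> (alg_unit B) = alg_unit C \<and>
     (\<forall>f\<in>alg B.
        (\<forall>c::complex. \<psi> (pointwise1 B (\<lambda>b. c \<cdot>\<^sub>m b) f) = pointwise1 C (\<lambda>b. c \<cdot>\<^sub>m b) (\<psi> f)) \<and>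
        \<psi> (pointwise1 B mat_adjoint f) = pointwise1 C mat_adjoint (\<psi> f) \<and>
        (\<forall>g\<in>alg B.
           \<psi> (pointwise2 B (+) f g) = pointwise2 C (+) (\<psi> f) (\<psi> g) \<and>
           \<psi> (pointwise2 B (*) f g) = pointwise2 C (*) (\<psi> f) (\<psi> g)))"

definition summand_incl :: "'a homog_sum \<Rightarrow> nat \<Rightarrow> ('a \<Rightarrow> complex mat) \<Rightarrow> 'a elem" where
  "summand_incl B l a = (\<lambda>l'\<in>{..<num B}. \<lambda>x\<in>topspace (base B l').
     if l' = l then a x else 0\<^sub>m (msize B l') (msize B l'))"


section \<open>Inductive systems with diagonal maps\<close>

text \<open>The \<open>R \<times> R\<close> block diagonal matrix whose diagonal blocks are the \<open>r \<times> r\<close> matrices \<open>b 0, \<dots>, b (M - 1)\<close>,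
  the block \<open>b m\<close> starting at row and column \<open>off m\<close>, and zeros elsewhere. The offsets
  are needed because the copies coming from the other summands of the domain occupy room as well, and
  because the projection defining the codomain need not be the identity matrix.\<close>

definition block_diag :: "nat \<Rightarrow> nat \<Rightarrow> nat \<Rightarrow> (nat \<Rightarrow> nat) \<Rightarrow> (nat \<Rightarrow> complex mat) \<Rightarrow> complex mat" where
  "block_diag R r M off b = mat R R (\<lambda>(s, t). \<Sum>m<M.
     if s \<in> {off m..<off m + r} \<and> t \<in> {off m..<off m + r} then b m $$ (s - off m, t - off m) else 0)"

definition disjoint_blocks :: "nat \<Rightarrow> nat \<Rightarrow> nat \<Rightarrow> (nat \<Rightarrow> nat) \<Rightarrow> bool" where
  "disjoint_blocks R r M off \<longleftrightarrow> (\<forall>m<M. off m + r \<le> R) \<and>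
     (\<forall>m<M. \<forall>m'<M. m \<noteq> m' \<longrightarrow> off m + r \<le> off m' \<or> off m' + r \<le> off m)"

text \<open>The component of \<open>\<psi>\<close> from summand \<open>l\<close> of \<open>B\<close> to summand \<open>k\<close> of \<open>C\<close> is
  \<open>f \<mapsto> diag (f \<circ> \<Lambda> 0, \<dots>, f \<circ> \<Lambda> (M - 1))\<close>; it is zero if \<open>M = 0\<close>.\<close>

definition diagonal_component ::
    "'a homog_sum \<Rightarrow> 'a homog_sum \<Rightarrow> ('a elem \<Rightarrow> 'a elem) \<Rightarrow> nat \<Rightarrow> nat \<Rightarrow> nat \<Rightarrow> (nat \<Rightarrow> 'a \<Rightarrow> 'a) \<Rightarrow> bool" where
  "diagonal_component B C \<psi> l k M \<Lambda> \<longleftrightarrow>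
     (\<forall>m<M. continuous_map (base C k) (base B l) (\<Lambda> m)) \<and>
     (\<exists>off. disjoint_blocks (msize C k) (msize B l) M off \<and>
        (\<forall>f\<in>summand B l. \<forall>y\<in>topspace (base C k).
           \<psi> (summand_incl B l f) k y =
             block_diag (msize C k) (msize B l) M off (\<lambda>m. f (\<Lambda> m y))))"

text \<open>\<open>\<phi>\<^bsub>i,j\<^esub> = \<phi>\<^bsub>j-1\<^esub> \<circ> \<dots> \<circ> \<phi>\<^sub>i\<close>\<close>

definition conn :: "(nat \<Rightarrow> 'a elem \<Rightarrow> 'a elem) \<Rightarrow> nat \<Rightarrow> nat \<Rightarrow> 'a elem \<Rightarrow> 'a elem" where
  "conn \<phi> i j = fold \<phi> [i..<j]"

text \<open>\<open>\<mu> i j l k\<close> is the number of eigenvalue maps \<open>\<Lambda> i j l k m : X\<^bsub>j,k\<^esub> \<rightarrow> X\<^bsub>i,l\<^esub>\<close>.\<close>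

definition AH_diagonal ::
    "(nat \<Rightarrow> 'a homog_sum) \<Rightarrow> (nat \<Rightarrow> 'a elem \<Rightarrow> 'a elem) \<Rightarrow>
     (nat \<Rightarrow> nat \<Rightarrow> nat \<Rightarrow> nat \<Rightarrow> nat) \<Rightarrow> (nat \<Rightarrow> nat \<Rightarrow> nat \<Rightarrow> nat \<Rightarrow> nat \<Rightarrow> 'a \<Rightarrow> 'a) \<Rightarrow> bool" where
  "AH_diagonal A \<phi> \<mu> \<Lambda> \<longleftrightarrow>
     (\<forall>i. homog_sum (A i)) \<and>
     (\<forall>i. unital_star_hom (A i) (A (Suc i)) (\<phi> i)) \<and>
     (\<forall>i j. i < j \<longrightarrow> (\<forall>l<num (A i). \<forall>k<num (A j).
        diagonal_component (A i) (A j) (conn \<phi> i j) l k (\<mu> i j l k) (\<Lambda> i j l k)))"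


section \<open>Mean dimension\<close>

definition base_space :: "'a homog_sum \<Rightarrow> (nat \<times> 'a) topology" where
  "base_space B = sum_topology (base B) {..<num B}"

definition component_covers :: "'a homog_sum \<Rightarrow> (nat \<times> 'a) set set set" where
  "component_covers B = {\<alpha>. fin_open_cover (base_space B) \<alpha> \<and>
     (\<forall>U\<in>\<alpha>. \<exists>l<num B. U \<subseteq> {l} \<times> topspace (base B l))}"

definition induced_cover :: "'a homog_sum \<Rightarrow> (nat \<times> 'a) set set \<Rightarrow> nat \<Rightarrow> 'a set set" where
  "induced_cover B \<alpha> l = (\<lambda>U. Pair l -` U) ` {U \<in> \<alpha>. U \<subseteq> {l} \<times> topspace (base B l)}"

definition transported_cover ::
    "(nat \<Rightarrow> 'a homog_sum) \<Rightarrow> (nat \<Rightarrow> nat \<Rightarrow> nat \<Rightarrow> nat \<Rightarrow> nat) \<Rightarrow>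
     (nat \<Rightarrow> nat \<Rightarrow> nat \<Rightarrow> nat \<Rightarrow> nat \<Rightarrow> 'a \<Rightarrow> 'a) \<Rightarrow> nat \<Rightarrow> nat \<Rightarrow> nat \<Rightarrow> (nat \<times> 'a) set set \<Rightarrow> 'a set set" where
  "transported_cover A \<mu> \<Lambda> i j k \<alpha> =
     join_covers (topspace (base (A j) k)) (SIGMA l:{..<num (A i)}. {..<\<mu> i j l k})
       (\<lambda>(l, m). pullback_cover (base (A j) k) (\<Lambda> i j l k m) (induced_cover (A i) \<alpha> l))"

text \<open>Only the indices \<open>j > i\<close> are meaningful in the limits over \<open>j\<close> below; the other ones do not
  influence the limit.\<close>

definition mean_dim_at ::
    "(nat \<Rightarrow> 'a homog_sum) \<Rightarrow> (nat \<Rightarrow> nat \<Rightarrow> nat \<Rightarrow> nat \<Rightarrow> nat) \<Rightarrow>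
     (nat \<Rightarrow> nat \<Rightarrow> nat \<Rightarrow> nat \<Rightarrow> nat \<Rightarrow> 'a \<Rightarrow> 'a) \<Rightarrow> nat \<Rightarrow> ereal" where
  "mean_dim_at A \<mu> \<Lambda> i = (SUP \<alpha>\<in>component_covers (A i).
     lim (\<lambda>j. ereal (MAX k\<in>{..<num (A j)}.
       real (cover_dim (base (A j) k) (transported_cover A \<mu> \<Lambda> i j k \<alpha>)) / real (prank (A j) k))))"

definition mean_dim ::
    "(nat \<Rightarrow> 'a homog_sum) \<Rightarrow> (nat \<Rightarrow> nat \<Rightarrow> nat \<Rightarrow> nat \<Rightarrow> nat) \<Rightarrow>
     (nat \<Rightarrow> nat \<Rightarrow> nat \<Rightarrow> nat \<Rightarrow> nat \<Rightarrow> 'a \<Rightarrow> 'a) \<Rightarrow> ereal" where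
  "mean_dim A \<mu> \<Lambda> = lim (mean_dim_at A \<mu> \<Lambda>)"


section \<open>Variation mean dimension\<close>

definition variation_covers :: "'a topology \<Rightarrow> ('a \<Rightarrow> complex mat) set \<Rightarrow> real \<Rightarrow> 'a set set set" where
  "variation_covers X F \<epsilon> = {\<alpha>. fin_open_cover X \<alpha> \<and>
     (\<forall>U\<in>\<alpha>. \<forall>x\<in>U. \<forall>y\<in>U. \<forall>f\<in>F. mat_opnorm (f x - f y) < \<epsilon>)}"

definition variation_dim :: "'a topology \<Rightarrow> ('a \<Rightarrow> complex mat) set \<Rightarrow> real \<Rightarrow> nat" where
  "variation_dim X F \<epsilon> = Inf (cover_ord X ` variation_covers X F \<epsilon>)"

definition var_mean_dim_at ::
    "(nat \<Rightarrow> 'a homog_sum) \<Rightarrow> (nat \<Rightarrow> 'a elem \<Rightarrow> 'a elem) \<Rightarrow> nat \<Rightarrow> ereal" where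
  "var_mean_dim_at A \<phi> i = (SUP (F, \<epsilon>)\<in>{(F, \<epsilon>). finite F \<and> F \<subseteq> alg (A i) \<and> 0 < \<epsilon>}.
     liminf (\<lambda>j. ereal (MAX k\<in>{..<num (A j)}.
       real (variation_dim (base (A j) k) ((\<lambda>f. conn \<phi> i j f k) ` F) \<epsilon>) / real (prank (A j) k))))"

definition var_mean_dim ::
    "(nat \<Rightarrow> 'a homog_sum) \<Rightarrow> (nat \<Rightarrow> 'a elem \<Rightarrow> 'a elem) \<Rightarrow> ereal" where
  "var_mean_dim A \<phi> = lim (var_mean_dim_at A \<phi>)"

end

theory Submission
  imports Defs
begin

unbundle no vec_syntax

text \<open>The two invariants agree already at every finite stage \<open>i\<close>, before the limit over \<open>i\<close> is taken. For a
  fixed stage, covers of the base spaces and finite sets of elements with a tolerance control each other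
  uniformly in all later stages \<open>j\<close>.

  Given finitely many elements and \<open>\<epsilon>\<close>, compactness yields a cover \<open>\<alpha>\<close> of the base spaces of stage \<open>i\<close> on
  whose members every component of the elements varies by less than \<open>\<epsilon> / h\<^sub>i\<close>. A diagonal map puts the
  values at the points \<open>\<lambda> (y)\<close> into disjoint diagonal blocks, and a block diagonal matrix is no larger in
  norm than its largest block, however many blocks there are; so every cover that refines
  \<open>\<phi>\<^bsub>i,j\<^esub>\<^sup>k (\<alpha>)\<close> is a variation cover for the images (lemma
  \<open>transported_refinements_in_variation_covers\<close>). Conversely, given \<open>\<alpha>\<close>, take the products of
  the projections with Urysohn functions \<open>g\<^sub>U\<close> supported in the members \<open>U\<close>. If the image of such an element
  varies by less than \<open>1\<close> on a set, then so does every block \<open>(g\<^sub>U p) (\<lambda> (y))\<close>, and since nonzero projections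
  have norm \<open>1\<close>, \<open>\<lambda>\<close> cannot map one point of the set to \<open>{g\<^sub>U \<ge> 1}\<close> and another one outside
  \<open>U\<close>. Hence variation covers for the images refine \<open>\<phi>\<^bsub>i,j\<^esub>\<^sup>k (\<alpha>)\<close> (lemma
  \<open>variation_covers_refine_transported\<close>).

  This compares the limit inferior in the definition of \<open>\<nu>\<^sub>i\<close> with the one of the sequence in the definition
  of \<open>\<gamma>\<^sub>i\<close>. It remains to see that the latter sequence converges, which it does because it
  decreases (lemma \<open>dim_ratio_decreasing\<close>). This rests on three facts.
  \<^item> \<open>\<D>\<close> is subadditive: \<open>\<D> (\<alpha> \<or> \<beta>) \<le> \<D> (\<alpha>) + \<D> (\<beta>)\<close> (lemmas \<open>common_refinement\<close> and
    \<open>common_refinement_family\<close>).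
  \<^item> The ranks fit: \<open>\<Sum>\<^sub>l m\<^bsub>j,j'\<^esub>\<^bsup>l,k\<^esup> n\<^bsub>j,l\<^esub> = n\<^bsub>j',k\<^esub>\<close>, by taking traces of the
    unit (lemma \<open>diagonal_hom_rank\<close>).
  \<^item> The maps \<open>\<lambda>\<^bsub>i,j'\<^esub>\<close> are composites of maps \<open>\<lambda>\<^bsub>i,j\<^esub>\<close> and \<open>\<lambda>\<^bsub>j,j'\<^esub>\<close>. These families are
    given independently of each other, and only the homomorphisms are known to compose; but the
    position of a block determines its eigenvalue map (lemma \<open>diagonal_maps_compose\<close>).\<close>


section \<open>Orders and refinements of open covers\<close>

lemma sum_indicator_eq_card:
  "finite \<beta> \<Longrightarrow> (\<Sum>U\<in>\<beta>. indicator U x :: nat) = card {U \<in> \<beta>. x \<in> U}"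
  by (simp add: indicator_def sum.If_cases Int_def)

lemma card_members_le_Suc_cover_ord:
  assumes "finite \<beta>" "x \<in> topspace X"
  shows "card {U \<in> \<beta>. x \<in> U} \<le> Suc (cover_ord X \<beta>)"
proof -
  let ?S = "(\<lambda>x. \<Sum>U\<in>\<beta>. indicator U x :: nat) ` topspace X"
  have "?S \<subseteq> {..card \<beta>}"
    using assms(1) by (auto simp: sum_indicator_eq_card intro!: card_mono)
  then have "finite ?S"
    by (rule finite_subset) simp
  then have "card {U \<in> \<beta>. x \<in> U} \<le> Max ?S"
    using assms by (intro Max_ge) (auto simp: sum_indicator_eq_card)
  then show ?thesis
    by (simp add: cover_ord_def)
qed

lemma cover_ord_leI:
  assumes "finite \<beta>" "topspace X \<noteq> {}"
    and "\<And>x. x \<in> topspace X \<Longrightarrow> card {U \<in> \<beta>. x \<in> U} \<le> Suc n"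
  shows "cover_ord X \<beta> \<le> n"
proof -
  let ?S = "(\<lambda>x. \<Sum>U\<in>\<beta>. indicator U x :: nat) ` topspace X"
  have *: "?S \<subseteq> {..Suc n}"
    using assms by (auto simp: sum_indicator_eq_card)
  then have "finite ?S"
    by (rule finite_subset) simp
  then have "Max ?S \<le> Suc n"
    using * assms(2) by (subst Max_le_iff) auto
  then show ?thesis
    by (simp add: cover_ord_def)
qed

lemma cover_dim_le:
  assumes "fin_open_cover X \<beta>" "refines \<beta> \<alpha>"
  shows "cover_dim X \<alpha> \<le> cover_ord X \<beta>"
  unfolding cover_dim_def using assms by (intro cInf_lower) auto

lemma cover_dim_attained:
  assumes "fin_open_cover X \<alpha>"
  obtains \<beta> where "fin_open_cover X \<beta>" "refines \<beta> \<alpha>" "cover_ord X \<beta> = cover_dim X \<alpha>"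
proof -
  let ?S = "{cover_ord X \<beta> |\<beta>. fin_open_cover X \<beta> \<and> refines \<beta> \<alpha>}"
  have "?S \<noteq> {}"
    using assms by (auto simp: refines_def)
  then have "Inf ?S \<in> ?S"
    by (rule Inf_nat_def1)
  then show ?thesis
    using that by (auto simp: cover_dim_def)
qed

lemma refines_trans: "refines \<gamma> \<beta> \<Longrightarrow> refines \<beta> \<alpha> \<Longrightarrow> refines \<gamma> \<alpha>"
  unfolding refines_def by (meson order_trans)

lemma fin_open_cover_pullback:
  assumes "fin_open_cover X \<beta>" "continuous_map Y X f"
  shows "fin_open_cover Y (pullback_cover Y f \<beta>)"
proof -
  have "topspace Y \<subseteq> \<Union>(pullback_cover Y f \<beta>)"
  proof
    fix y assume y: "y \<in> topspace Y"
    then have "f y \<in> \<Union>\<beta>"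
      using assms by (auto simp: fin_open_cover_def continuous_map_def)
    then show "y \<in> \<Union>(pullback_cover Y f \<beta>)"
      using y by (auto simp: pullback_cover_def)
  qed
  then show ?thesis
    using assms
    by (auto simp: fin_open_cover_def pullback_cover_def intro: openin_continuous_map_preimage)
qed

lemma cover_ord_pullback_le:
  assumes "fin_open_cover X \<beta>" "continuous_map Y X f" "topspace Y \<noteq> {}"
  shows "cover_ord Y (pullback_cover Y f \<beta>) \<le> cover_ord X \<beta>"
proof (rule cover_ord_leI)
  show "finite (pullback_cover Y f \<beta>)"
    using fin_open_cover_pullback[OF assms(1,2)] by (simp add: fin_open_cover_def)
next
  fix y assume y: "y \<in> topspace Y"
  have fin: "finite \<beta>"
    using assms by (simp add: fin_open_cover_def)
  have "card {V \<in> pullback_cover Y f \<beta>. y \<in> V} \<le> card {U \<in> \<beta>. f y \<in> U}"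
    using fin by (intro surj_card_le[where f = "\<lambda>U. {y \<in> topspace Y. f y \<in> U}"])
      (auto simp: pullback_cover_def)
  also have "\<dots> \<le> Suc (cover_ord X \<beta>)"
    using y assms(2) fin by (intro card_members_le_Suc_cover_ord) (auto simp: continuous_map_def)
  finally show "card {V \<in> pullback_cover Y f \<beta>. y \<in> V} \<le> Suc (cover_ord X \<beta>)" .
qed (use assms in auto)

text \<open>These functions serve two purposes: suitably normalised they form a partition of unity subordinate to
  \<open>\<beta>\<close>, and multiplied with a projection they give elements of the algebra that tell apart the members
  of \<open>\<beta>\<close>. For the latter the uniform lower bound \<open>1\<close> matters.\<close>

lemma bump_functions:
  assumes X: "compact_space X" "Hausdorff_space X" and \<beta>: "fin_open_cover X \<beta>"
  obtains g :: "'a set \<Rightarrow> 'a \<Rightarrow> real"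
  where "\<And>U. continuous_map X euclideanreal (g U)"
    and "\<And>U x. x \<in> topspace X \<Longrightarrow> 0 \<le> g U x"
    and "\<And>U x. x \<in> topspace X \<Longrightarrow> x \<notin> U \<Longrightarrow> g U x = 0"
    and "\<And>x. x \<in> topspace X \<Longrightarrow> \<exists>U\<in>\<beta>. 1 \<le> g U x"
proof -
  have normal: "normal_space X"
    using X compact_Hausdorff_or_regular_imp_normal_space by blast
  define Q where "Q x U h \<longleftrightarrow> U \<in> \<beta> \<and> continuous_map X euclideanreal h \<and>
      (\<forall>y\<in>topspace X. 0 \<le> h y) \<and> h x = 2 \<and> (\<forall>y\<in>topspace X. y \<notin> U \<longrightarrow> h y = 0)"
    for x U and h :: "'a \<Rightarrow> real"
  have "\<exists>U h. Q x U h" if x: "x \<in> topspace X" for x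
  proof -
    obtain U where U: "U \<in> \<beta>" "x \<in> U" "openin X U"
      using x \<beta> by (auto simp: fin_open_cover_def)
    obtain h where h: "continuous_map X (top_of_set {0..2}) h"
        "h ` (topspace X - U) \<subseteq> {0}" "h ` {x} \<subseteq> {2::real}"
    proof -
      have "closedin X {x}"
        using x X by (simp add: closedin_Hausdorff_singleton)
      moreover have "closedin X (topspace X - U)" "disjnt (topspace X - U) {x}"
        using U by auto
      ultimately show ?thesis
        using Urysohn_lemma[OF normal, of "topspace X - U" "{x}" 0 2] that by (smt (verit))
    qed
    have "continuous_map X euclideanreal h" "\<forall>y\<in>topspace X. 0 \<le> h y"
      using h(1) by (auto simp: continuous_map_in_subtopology image_subset_iff)
    moreover have "h x = 2" "\<forall>y\<in>topspace X. y \<notin> U \<longrightarrow> h y = 0"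
      using h by auto
    ultimately show ?thesis
      using U(1) unfolding Q_def by blast
  qed
  then obtain N h where Q: "\<And>x. x \<in> topspace X \<Longrightarrow> Q x (N x) (h x)"
    by metis
  have N: "\<And>x. x \<in> topspace X \<Longrightarrow> N x \<in> \<beta>"
    and h: "\<And>x. x \<in> topspace X \<Longrightarrow> continuous_map X euclideanreal (h x)"
      "\<And>x y. x \<in> topspace X \<Longrightarrow> y \<in> topspace X \<Longrightarrow> 0 \<le> h x y"
      "\<And>x. x \<in> topspace X \<Longrightarrow> h x x = (2::real)"
      "\<And>x y. x \<in> topspace X \<Longrightarrow> y \<in> topspace X \<Longrightarrow> y \<notin> N x \<Longrightarrow> h x y = 0"
    by (simp_all add: Q[unfolded Q_def])
  let ?V = "\<lambda>x. {y \<in> topspace X. h x y \<in> {1<..}}"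
  have "openin X (?V x)" if "x \<in> topspace X" for x
    using h(1)[OF that] by (intro openin_continuous_map_preimage[where Y = euclideanreal]) auto
  moreover have "topspace X \<subseteq> \<Union>(?V ` topspace X)"
    using h(3) by force
  ultimately have "\<exists>P. finite P \<and> P \<subseteq> ?V ` topspace X \<and> topspace X \<subseteq> \<Union>P"
    using X(1)[unfolded compact_space_alt, rule_format, of "?V ` topspace X"] by (simp add: image_iff)
  then obtain P where P: "finite P" "P \<subseteq> topspace X" "topspace X \<subseteq> \<Union>(?V ` P)"
    by (metis (lifting) finite_subset_image)
  define g where "g U y = (\<Sum>x | x \<in> P \<and> N x = U. h x y)" for U y
  show ?thesis
  proof (rule that[of g])
    show "continuous_map X euclideanreal (g U)" for U
      unfolding g_def using P h(1) by (intro continuous_map_sum) auto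
    show "0 \<le> g U y" if "y \<in> topspace X" for U y
      unfolding g_def using P(2) h(2) that by (intro sum_nonneg) auto
    show "g U y = 0" if "y \<in> topspace X" "y \<notin> U" for U y
      unfolding g_def using P(2) h(4) that by (intro sum.neutral) auto
    show "\<exists>U\<in>\<beta>. 1 \<le> g U y" if y: "y \<in> topspace X" for y
    proof -
      obtain x where x: "x \<in> P" "h x y > 1"
        using P(3) y by auto
      have "h x y \<le> g (N x) y"
        unfolding g_def using P h(2) x y by (intro member_le_sum) auto
      then show ?thesis
        using N x P by force
    qed
  qed
qed

text \<open>A partition of unity \<open>f\<^sub>0, \<dots>, f\<^bsub>n-1\<^esub>\<close> whose partial sums \<open>F\<^sub>i = f\<^sub>0 + \<dots> + f\<^bsub>i-1\<^esub>\<close> cut the unit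
  interval, at every point \<open>x\<close>, into consecutive intervals of lengths \<open>f\<^sub>i (x)\<close>.\<close>

lemma interval_partition:
  assumes X: "compact_space X" "Hausdorff_space X" and \<beta>: "fin_open_cover X \<beta>"
  obtains n and F :: "nat \<Rightarrow> 'a \<Rightarrow> real" and U :: "nat \<Rightarrow> 'a set"
  where "bij_betw U {..<n} \<beta>"
    and "\<And>i. continuous_map X euclideanreal (F i)"
    and "\<And>x. F 0 x = 0"
    and "\<And>x. x \<in> topspace X \<Longrightarrow> F n x = 1"
    and "\<And>x i j. x \<in> topspace X \<Longrightarrow> i \<le> j \<Longrightarrow> F i x \<le> F j x"
    and "\<And>x i. x \<in> topspace X \<Longrightarrow> F i x < F (Suc i) x \<Longrightarrow> x \<in> U i"
proof -
  obtain g where g: "\<And>U. continuous_map X euclideanreal (g U)"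
      "\<And>U x. x \<in> topspace X \<Longrightarrow> (0::real) \<le> g U x"
      "\<And>U x. x \<in> topspace X \<Longrightarrow> x \<notin> U \<Longrightarrow> g U x = 0"
      "\<And>x. x \<in> topspace X \<Longrightarrow> \<exists>U\<in>\<beta>. 1 \<le> g U x"
    using bump_functions[OF X \<beta>] by metis
  have "finite \<beta>"
    using \<beta> by (simp add: fin_open_cover_def)
  then obtain U where U: "bij_betw U {..<card \<beta>} \<beta>"
    using ex_bij_betw_nat_finite[of \<beta>] by (auto simp: lessThan_atLeast0)
  define n where "n = card \<beta>"
  define T where "T x = (\<Sum>k<n. g (U k) x)" for x
  define F where "F i x = (\<Sum>k<i. g (U k) x) / T x" for i x
  have T: "T x > 0" if x: "x \<in> topspace X" for x
  proof -
    obtain k where k: "k < n" "1 \<le> g (U k) x"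
      using g(4)[OF x] U unfolding bij_betw_def n_def by (metis imageE lessThan_iff)
    then have "g (U k) x \<le> T x"
      unfolding T_def using g(2) x by (intro member_le_sum) auto
    then show ?thesis
      using k by simp
  qed
  show ?thesis
  proof (rule that[of U n F])
    show "bij_betw U {..<n} \<beta>"
      using U by (simp add: n_def)
    show "continuous_map X euclideanreal (F i)" for i
      unfolding F_def using T g(1)
      by (intro continuous_map_real_divide) (force simp: T_def intro!: continuous_map_sum)+
    show "F 0 x = 0" for x
      by (simp add: F_def)
    show "F n x = 1" if "x \<in> topspace X" for x
      using T[OF that] by (simp add: F_def T_def)
    show "F i x \<le> F j x" if "x \<in> topspace X" "i \<le> j" for i j x
      unfolding F_def using T[OF that(1)] g(2)[OF that(1)] that(2)
      by (intro divide_right_mono sum_mono2) auto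
    show "x \<in> U i" if "x \<in> topspace X" "F i x < F (Suc i) x" for i x
      using that T[OF that(1)] g(3)[OF that(1)] by (force simp: F_def add_divide_distrib)
  qed
qed

text \<open>A chain in the product order of \<open>A \<times> B\<close>, graded by the sum of the ranks of the two coordinates, has
  at most \<open>|A| + |B| - 1\<close> elements.\<close>

lemma card_chain_le:
  fixes S :: "(nat \<times> nat) set"
  assumes AB: "finite A" "finite B" "S \<subseteq> A \<times> B" "S \<noteq> {}"
    and chain: "\<And>i j i' j'. (i, j) \<in> S \<Longrightarrow> (i', j') \<in> S \<Longrightarrow> i < i' \<Longrightarrow> j \<le> j'"
  shows "Suc (card S) \<le> card A + card B"
proof -
  define r where "r = (\<lambda>(i, j). card (A \<inter> {..<i}) + card (B \<inter> {..<j}))"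
  have mono: "card (C \<inter> {..<i}) \<le> card (C \<inter> {..<j})" if "i \<le> j" "finite C" for C and i j :: nat
    using that by (intro card_mono) auto
  have strict: "card (C \<inter> {..<i}) < card (C \<inter> {..<j})" if "i < j" "finite C" "i \<in> C"
    for C and i j :: nat
    using that by (intro psubset_card_mono) auto
  have less: "r (i, j) < r (i', j')"
    if "(i, j) \<in> S" "(i', j') \<in> S" "i < i' \<or> i = i' \<and> j < j'" for i j i' j'
  proof -
    have "i \<in> A" "j \<in> B"
      using AB(3) that(1) by auto
    then show ?thesis
      using strict[of i i' A] strict[of j j' B] mono[of j j' B] chain[OF that(1,2)] that AB
      by (auto simp: r_def add_less_le_mono)
  qed
  have "inj_on r S"
  proof (rule inj_onI, rule ccontr)
    fix p q assume pq: "p \<in> S" "q \<in> S" "r p = r q" "p \<noteq> q"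
    obtain i j i' j' where [simp]: "p = (i, j)" "q = (i', j')"
      by (cases p, cases q)
    consider "i < i' \<or> i = i' \<and> j < j'" | "i' < i \<or> i' = i \<and> j' < j"
      using pq(4) by fastforce
    then show False
      using less[of i j i' j'] less[of i' j' i j] pq by cases auto
  qed
  moreover have "r ` S \<subseteq> {..<card A + card B - 1}"
  proof (rule image_subsetI)
    fix p assume "p \<in> S"
    moreover obtain i j where p: "p = (i, j)"
      by (cases p)
    ultimately have "i \<in> A" "j \<in> B"
      using AB(3) by auto
    then have "card (A \<inter> {..<i}) < card A" "card (B \<inter> {..<j}) < card B"
      using AB by (auto intro!: psubset_card_mono)
    then show "r p \<in> {..<card A + card B - 1}"
      by (simp add: r_def p)
  qed
  ultimately have "card S \<le> card A + card B - 1"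
    using card_inj_on_le[of r S "{..<card A + card B - 1}"] by simp
  moreover have "card A > 0"
    using AB by (auto simp: card_gt_0_iff)
  ultimately show ?thesis
    by simp
qed

text \<open>Subadditivity of covering dimension, without triangulating a product of simplices. At each point
  \<open>x\<close> two partitions of unity cut the unit interval into at most \<open>ord (\<alpha>) + 1\<close> and \<open>ord (\<beta>) + 1\<close> intervals
  of positive length. The new cover consists of the sets where the \<open>i\<close>-th interval of the first partition
  and the \<open>j\<close>-th interval of the second one overlap. Along the unit interval the overlapping pairs form a
  chain, so that at most \<open>ord (\<alpha>) + ord (\<beta>) + 1\<close> of these sets contain \<open>x\<close>.\<close>

lemma common_refinement:
  assumes X: "compact_space X" "Hausdorff_space X" "topspace X \<noteq> {}"
    and \<alpha>: "fin_open_cover X \<alpha>" and \<beta>: "fin_open_cover X \<beta>"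
  obtains \<gamma> where "fin_open_cover X \<gamma>" "refines \<gamma> \<alpha>" "refines \<gamma> \<beta>"
    "cover_ord X \<gamma> \<le> cover_ord X \<alpha> + cover_ord X \<beta>"
proof -
  obtain n and F :: "nat \<Rightarrow> 'a \<Rightarrow> real" and U where U: "bij_betw U {..<n} \<alpha>"
    and F: "\<And>i. continuous_map X euclideanreal (F i)" "\<And>x. F 0 x = 0"
      "\<And>x. x \<in> topspace X \<Longrightarrow> F n x = 1"
      "\<And>x i j. x \<in> topspace X \<Longrightarrow> i \<le> j \<Longrightarrow> F i x \<le> F j x"
      "\<And>x i. x \<in> topspace X \<Longrightarrow> F i x < F (Suc i) x \<Longrightarrow> x \<in> U i"
    using interval_partition[OF X(1,2) \<alpha>] by metis
  obtain m and G :: "nat \<Rightarrow> 'a \<Rightarrow> real" and V where V: "bij_betw V {..<m} \<beta>"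
    and G: "\<And>i. continuous_map X euclideanreal (G i)" "\<And>x. G 0 x = 0"
      "\<And>x. x \<in> topspace X \<Longrightarrow> G m x = 1"
      "\<And>x i j. x \<in> topspace X \<Longrightarrow> i \<le> j \<Longrightarrow> G i x \<le> G j x"
      "\<And>x i. x \<in> topspace X \<Longrightarrow> G i x < G (Suc i) x \<Longrightarrow> x \<in> V i"
    using interval_partition[OF X(1,2) \<beta>] by metis
  define W where "W = (\<lambda>(i, j). {x \<in> topspace X.
      min (F (Suc i) x) (G (Suc j) x) - max (F i x) (G j x) \<in> {0<..}})"
  define \<gamma> where "\<gamma> = W ` ({..<n} \<times> {..<m})"
  have in_W: "x \<in> W (i, j) \<longleftrightarrow> x \<in> topspace X \<and> F i x < F (Suc i) x \<and> G j x < G (Suc j) x \<and>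
      F i x < G (Suc j) x \<and> G j x < F (Suc i) x" for x i j
    by (auto simp: W_def)
  \<comment> \<open>The first intervals of positive length of both partitions start at 0 and hence overlap.\<close>
  have first: "\<exists>i<n. H i x \<le> 0 \<and> 0 < H (Suc i) x"
    if H: "H 0 x = 0" "H n x = 1" for H :: "nat \<Rightarrow> 'a \<Rightarrow> real" and n x
  proof -
    define k where "k = (LEAST k. H k x > 0)"
    have k: "H k x > 0" "k \<le> n"
      unfolding k_def using H by (auto intro: LeastI[of _ n] Least_le)
    then obtain i where i: "k = Suc i"
      using H(1) k(1) by (cases k) auto
    then have "\<not> H i x > 0"
      unfolding k_def by (intro not_less_Least) simp
    then show ?thesis
      using k i by force
  qed
  have cover: "fin_open_cover X \<gamma>"
    unfolding fin_open_cover_def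
  proof (intro conjI ballI)
    show "finite \<gamma>"
      by (simp add: \<gamma>_def)
    show "openin X A" if "A \<in> \<gamma>" for A
      using that F(1) G(1) unfolding \<gamma>_def W_def
      by (auto intro!: openin_continuous_map_preimage continuous_map_diff
          continuous_map_real_min continuous_map_real_max simp del: greaterThan_iff)
    show "\<Union>\<gamma> = topspace X"
    proof
      show "topspace X \<subseteq> \<Union>\<gamma>"
      proof
        fix x assume x: "x \<in> topspace X"
        obtain i j where "i < n" "F i x \<le> 0" "0 < F (Suc i) x" "j < m" "G j x \<le> 0" "0 < G (Suc j) x"
          using first[of F x n] first[of G x m] F(2,3) G(2,3) x by metis
        then have "(i, j) \<in> {..<n} \<times> {..<m}" "x \<in> W (i, j)"
          using x by (auto simp: in_W)
        then show "x \<in> \<Union>\<gamma>"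
          unfolding \<gamma>_def by blast
      qed
    qed (auto simp: \<gamma>_def W_def)
  qed
  moreover have "refines \<gamma> \<alpha>" "refines \<gamma> \<beta>"
  proof -
    have "W (i, j) \<subseteq> U i" "W (i, j) \<subseteq> V j" for i j
      using F(5) G(5) by (auto simp: in_W)
    moreover have "\<exists>i j. D = W (i, j) \<and> U i \<in> \<alpha> \<and> V j \<in> \<beta>" if "D \<in> \<gamma>" for D
      using that U V by (fastforce simp: \<gamma>_def bij_betw_def)
    ultimately show "refines \<gamma> \<alpha>" "refines \<gamma> \<beta>"
      unfolding refines_def by metis+
  qed
  moreover have "cover_ord X \<gamma> \<le> cover_ord X \<alpha> + cover_ord X \<beta>"
  proof (rule cover_ord_leI)
    fix x assume x: "x \<in> topspace X"
    define A where "A = {i. i < n \<and> F i x < F (Suc i) x}"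
    define B where "B = {j. j < m \<and> G j x < G (Suc j) x}"
    define S where "S = {p \<in> {..<n} \<times> {..<m}. x \<in> W p}"
    have "card {D \<in> \<gamma>. x \<in> D} \<le> card S"
      by (intro surj_card_le[where f = W]) (auto simp: \<gamma>_def S_def)
    also have "Suc \<dots> \<le> card A + card B"
    proof (rule card_chain_le)
      show "finite A" "finite B"
        by (auto simp: A_def B_def)
      show "S \<subseteq> A \<times> B"
        by (auto simp: S_def A_def B_def in_W)
      show "S \<noteq> {}"
        using cover x by (fastforce simp: fin_open_cover_def \<gamma>_def S_def)
      fix i j i' j' assume ij: "(i, j) \<in> S" "(i', j') \<in> S" "i < i'"
      show "j \<le> j'"
      proof (rule ccontr)
        assume "\<not> j \<le> j'"
        then have "G (Suc j') x \<le> G j x"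
          using G(4) x by simp
        moreover have "F (Suc i) x \<le> F i' x"
          using F(4) x ij(3) by simp
        ultimately show False
          using ij(1,2) by (auto simp: S_def in_W)
      qed
    qed
    also have "card A \<le> Suc (cover_ord X \<alpha>)"
    proof -
      have "card A \<le> card {D \<in> \<alpha>. x \<in> D}"
        using U F(5) x \<alpha> by (intro card_inj_on_le[of U])
          (auto simp: A_def bij_betw_def fin_open_cover_def intro: inj_on_subset)
      also have "\<dots> \<le> Suc (cover_ord X \<alpha>)"
        using \<alpha> x by (intro card_members_le_Suc_cover_ord) (auto simp: fin_open_cover_def)
      finally show ?thesis .
    qed
    also have "card B \<le> Suc (cover_ord X \<beta>)"
    proof -
      have "card B \<le> card {D \<in> \<beta>. x \<in> D}"
        using V G(5) x \<beta> by (intro card_inj_on_le[of V])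
          (auto simp: B_def bij_betw_def fin_open_cover_def intro: inj_on_subset)
      also have "\<dots> \<le> Suc (cover_ord X \<beta>)"
        using \<beta> x by (intro card_members_le_Suc_cover_ord) (auto simp: fin_open_cover_def)
      finally show ?thesis .
    qed
    finally show "card {D \<in> \<gamma>. x \<in> D} \<le> Suc (cover_ord X \<alpha> + cover_ord X \<beta>)"
      by simp
  qed (use cover X in \<open>auto simp: fin_open_cover_def\<close>)
  ultimately show ?thesis
    using that by blast
qed

lemma common_refinement_family:
  assumes "compact_space X" "Hausdorff_space X" "topspace X \<noteq> {}"
    and "finite I" "\<And>i. i \<in> I \<Longrightarrow> fin_open_cover X (C i)"
  shows "\<exists>\<gamma>. fin_open_cover X \<gamma> \<and> (\<forall>i\<in>I. refines \<gamma> (C i)) \<and>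
    cover_ord X \<gamma> \<le> (\<Sum>i\<in>I. cover_ord X (C i))"
  using assms(4,5)
proof (induction I)
  case empty
  have "cover_ord X {topspace X} \<le> 0"
  proof (rule cover_ord_leI)
    fix x assume "x \<in> topspace X"
    then have "{U \<in> {topspace X}. x \<in> U} = {topspace X}"
      by auto
    then show "card {U \<in> {topspace X}. x \<in> U} \<le> Suc 0"
      by simp
  qed (use assms in auto)
  then show ?case
    by (intro exI[of _ "{topspace X}"]) (auto simp: fin_open_cover_def)
next
  case (insert i I)
  then obtain \<gamma> where \<gamma>: "fin_open_cover X \<gamma>" "\<forall>i\<in>I. refines \<gamma> (C i)"
      "cover_ord X \<gamma> \<le> (\<Sum>i\<in>I. cover_ord X (C i))"
    by auto
  obtain \<delta> where \<delta>: "fin_open_cover X \<delta>" "refines \<delta> (C i)" "refines \<delta> \<gamma>"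
      "cover_ord X \<delta> \<le> cover_ord X (C i) + cover_ord X \<gamma>"
    using common_refinement[OF assms(1-3) _ \<gamma>(1), of "C i"] insert.prems by auto
  then have "\<forall>k\<in>insert i I. refines \<delta> (C k)"
    using \<gamma>(2) refines_trans by blast
  then show ?case
    using \<delta> \<gamma>(3) insert.hyps by (intro exI[of _ \<delta>]) auto
qed


section \<open>Rank and operator norm of complex matrices\<close>

text \<open>Let \<open>S\<close> be a basis of the column space, made up of columns of \<open>P\<close>. Writing the columns of \<open>P\<close> in this
  basis factors \<open>P\<close> as \<open>S a\<close> with a coefficient matrix \<open>a\<close>. The columns of an idempotent are fixed by it, so
  \<open>S (a S) = S\<close>, which gives \<open>a S = 1\<close> by independence; now \<open>tr (S a) = tr (a S) = |S|\<close>.\<close>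

lemma (in vec_space) trace_idempotent_eq_rank:
  assumes P: "P \<in> carrier_mat n n" and idem: "P * P = P"
  shows "(\<Sum>s<n. P $$ (s, s)) = of_nat (rank P)"
proof -
  have cols: "set (cols P) \<subseteq> carrier_vec n"
    using P cols_dim by blast
  obtain S where S: "maximal S (\<lambda>T. T \<subseteq> set (cols P) \<and> lin_indpt T)"
    using maximal_exists_superset[of "set (cols P)" "\<lambda>T. T \<subseteq> set (cols P) \<and> lin_indpt T" "{}"]
    by (meson List.finite_set empty_iff empty_subsetI finite_lin_indpt2 finite.emptyI)
  then have S_cols: "S \<subseteq> set (cols P)" and S_indpt: "lin_indpt S"
    by (auto simp: maximal_def)
  then have S_vec: "S \<subseteq> carrier_vec n" and fin: "finite S"
    using cols finite_subset by auto
  have rank: "rank P = card S"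
    using rank_card_indpt[OF P S] .
  have "col P j \<in> span S" if j: "j < n" for j
  proof (cases "col P j \<in> S")
    case True
    then show ?thesis
      using S_vec span_mem by auto
  next
    case False
    have mem: "col P j \<in> set (cols P)"
      using j P by (auto simp: cols_def)
    then have "\<not> lin_indpt (insert (col P j) S)"
      using S S_cols False unfolding maximal_def by (metis insert_iff insert_subset subset_insertI)
    then show ?thesis
      using lin_dep_iff_in_span[OF S_vec S_indpt _ False] mem cols by auto
  qed
  then have "\<forall>j\<in>{..<n}. \<exists>a. lincomb a S = col P j"
    using finite_in_span[OF fin] S_vec by fastforce
  then obtain a where a: "\<And>j. j < n \<Longrightarrow> lincomb (a j) S = col P j"
    using bchoice[of "{..<n}"] by (metis lessThan_iff)
  have entry: "P $$ (i, j) = (\<Sum>s\<in>S. a j s * s $ i)" if "i < n" "j < n" for i j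
    using that P a[OF that(2)] lincomb_index[OF that(1) S_vec, of "a j"] by auto
  have fixed: "s $ i = (\<Sum>j<n. P $$ (i, j) * s $ j)" if s: "s \<in> S" and i: "i < n" for s i
  proof -
    obtain j where j: "j < n" "s = col P j"
      using s S_cols P by (auto simp: cols_def)
    have "s $ i = (P * P) $$ (i, j)"
      using i j P idem by simp
    also have "\<dots> = (\<Sum>k<n. P $$ (i, k) * s $ k)"
      using i j P by (auto simp: scalar_prod_def lessThan_atLeast0 intro!: sum.cong)
    finally show ?thesis .
  qed
  define R where "R s' s = (\<Sum>j<n. a j s' * s $ j)" for s' s
  have R: "R s' s = of_bool (s' = s)" if s: "s \<in> S" "s' \<in> S" for s s'
  proof -
    let ?f = "\<lambda>s'. R s' s - of_bool (s' = s)"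
    have "lincomb ?f S = 0\<^sub>v n"
    proof (rule eq_vecI)
      fix i assume "i < dim_vec (0\<^sub>v n :: 'a vec)"
      then have i: "i < n"
        by simp
      have "lincomb ?f S $ i = (\<Sum>s'\<in>S. ?f s' * s' $ i)"
        using lincomb_index[OF i S_vec] .
      also have "\<dots> = (\<Sum>s'\<in>S. R s' s * s' $ i) - (\<Sum>s'\<in>S. if s' = s then s' $ i else 0)"
        by (simp only: left_diff_distrib sum_subtractf, intro arg_cong2[where f = "(-)"] refl) (auto simp: of_bool_def intro!: sum.cong)
      also have "(\<Sum>s'\<in>S. if s' = s then s' $ i else 0) = s $ i"
        using s(1) fin by simp
      also have "(\<Sum>s'\<in>S. R s' s * s' $ i) = (\<Sum>j<n. P $$ (i, j) * s $ j)"
        using i by (simp add: R_def sum_distrib_right entry, subst sum.swap)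
          (auto intro!: sum.cong simp: mult_ac)
      also have "\<dots> = s $ i"
        using fixed[OF s(1) i] by simp
      finally show "lincomb ?f S $ i = 0\<^sub>v n $ i"
        using i by simp
    next
      have "lincomb ?f S \<in> carrier_vec n"
        using S_vec by (intro lincomb_closed) auto
      then show "dim_vec (lincomb ?f S) = dim_vec (0\<^sub>v n :: 'a vec)"
        by simp
    qed
    then have "?f \<in> S \<rightarrow> {0}"
      using not_lindepD[OF S_indpt fin subset_refl, of ?f] by auto
    then have "?f s' = 0"
      using s(2) by (meson PiE singletonD)
    then show ?thesis
      by simp
  qed
  have "(\<Sum>i<n. P $$ (i, i)) = (\<Sum>s\<in>S. R s s)"
    by (simp add: R_def entry, rule sum.swap)
  also have "\<dots> = of_nat (card S)"
    by (simp add: R)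
  finally show ?thesis
    using rank by simp
qed

lemma vec_l2norm_eq_L2_set: "vec_l2norm v = L2_set (\<lambda>s. cmod (v $ s)) {..<dim_vec v}"
  by (simp add: vec_l2norm_def L2_set_def)

lemma vec_l2norm_nonneg [simp]: "0 \<le> vec_l2norm v"
  by (simp add: vec_l2norm_eq_L2_set)

lemma vec_l2norm_zero [simp]: "vec_l2norm (0\<^sub>v n) = 0"
  by (simp add: vec_l2norm_def)

lemma vec_l2norm_smult: "vec_l2norm (c \<cdot>\<^sub>v v) = cmod c * vec_l2norm v"
  by (simp add: vec_l2norm_eq_L2_set norm_mult L2_set_right_distrib cong: L2_set_cong_simp)

lemma vec_l2norm_power2: "(vec_l2norm v)\<^sup>2 = (\<Sum>s<dim_vec v. (cmod (v $ s))\<^sup>2)"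
  by (simp add: vec_l2norm_def sum_nonneg)

text \<open>An upper bound for the operator norm, in a form that avoids the supremum.\<close>

definition l2_bounded :: "complex mat \<Rightarrow> real \<Rightarrow> bool" where
  "l2_bounded B c \<longleftrightarrow> (\<forall>v\<in>carrier_vec (dim_col B). vec_l2norm (B *\<^sub>v v) \<le> c * vec_l2norm v)"

lemma mult_mat_vec_index:
  assumes "s < dim_row B" "v \<in> carrier_vec (dim_col B)"
  shows "(B *\<^sub>v v) $ s = (\<Sum>t<dim_col B. B $$ (s, t) * v $ t)"
  using assms by (auto simp: scalar_prod_def lessThan_atLeast0 intro!: sum.cong)

lemma l2_bounded_entry_sum:
  "l2_bounded B (\<Sum>s<dim_row B. \<Sum>t<dim_col B. cmod (B $$ (s, t)))"
  unfolding l2_bounded_def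
proof
  fix v :: "complex vec" assume v: "v \<in> carrier_vec (dim_col B)"
  have "vec_l2norm (B *\<^sub>v v) \<le> (\<Sum>s<dim_row B. cmod ((B *\<^sub>v v) $ s))"
    using L2_set_le_sum_abs[of "\<lambda>s. cmod ((B *\<^sub>v v) $ s)" "{..<dim_row B}"]
    by (simp add: vec_l2norm_eq_L2_set)
  also have "\<dots> \<le> (\<Sum>s<dim_row B. \<Sum>t<dim_col B. cmod (B $$ (s, t)) * vec_l2norm v)"
  proof (rule sum_mono)
    fix s assume s: "s \<in> {..<dim_row B}"
    have "cmod ((B *\<^sub>v v) $ s) \<le> (\<Sum>t<dim_col B. cmod (B $$ (s, t) * v $ t))"
      using s v by (subst mult_mat_vec_index) (auto intro: norm_sum)
    also have "\<dots> \<le> (\<Sum>t<dim_col B. cmod (B $$ (s, t)) * vec_l2norm v)"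
      using v member_le_L2_set[of "{..<dim_col B}" _ "\<lambda>s. cmod (v $ s)"]
      by (auto intro!: sum_mono mult_left_mono simp: norm_mult vec_l2norm_eq_L2_set)
    finally show "cmod ((B *\<^sub>v v) $ s) \<le> (\<Sum>t<dim_col B. cmod (B $$ (s, t)) * vec_l2norm v)" .
  qed
  finally show "vec_l2norm (B *\<^sub>v v)
      \<le> (\<Sum>s<dim_row B. \<Sum>t<dim_col B. cmod (B $$ (s, t))) * vec_l2norm v"
    by (simp add: sum_distrib_right)
qed

lemma mat_opnorm_le:
  assumes "l2_bounded B c" "0 \<le> c"
  shows "mat_opnorm B \<le> c"
  unfolding mat_opnorm_def
proof (rule cSup_least)
  show "{vec_l2norm (B *\<^sub>v v) |v. v \<in> carrier_vec (dim_col B) \<and> vec_l2norm v \<le> 1} \<noteq> {}"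
    by (auto intro!: exI[of _ "0\<^sub>v (dim_col B)"])
  fix x assume "x \<in> {vec_l2norm (B *\<^sub>v v) |v. v \<in> carrier_vec (dim_col B) \<and> vec_l2norm v \<le> 1}"
  then obtain v where "v \<in> carrier_vec (dim_col B)" "vec_l2norm v \<le> 1" "x = vec_l2norm (B *\<^sub>v v)"
    by blast
  then show "x \<le> c"
    using assms mult_left_mono[of "vec_l2norm v" 1 c] unfolding l2_bounded_def by fastforce
qed

lemma l2_bounded_mat_opnorm: "l2_bounded B (mat_opnorm B)"
  unfolding l2_bounded_def
proof
  \<comment> \<open>The crude bound \<open>?K\<close> shows that the supremum defining the norm is that of a bounded set.\<close>
  let ?K = "\<Sum>s<dim_row B. \<Sum>t<dim_col B. cmod (B $$ (s, t))"
  let ?S = "{vec_l2norm (B *\<^sub>v v) |v. v \<in> carrier_vec (dim_col B) \<and> vec_l2norm v \<le> 1}"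
  have K: "vec_l2norm (B *\<^sub>v v) \<le> ?K * vec_l2norm v" if "v \<in> carrier_vec (dim_col B)" for v
    using l2_bounded_entry_sum that unfolding l2_bounded_def by blast
  have K0: "0 \<le> ?K"
    by (intro sum_nonneg) auto
  have bdd: "bdd_above ?S"
  proof (rule bdd_aboveI)
    fix x assume "x \<in> ?S"
    then obtain v where "v \<in> carrier_vec (dim_col B)" "vec_l2norm v \<le> 1"
        "x = vec_l2norm (B *\<^sub>v v)"
      by blast
    then show "x \<le> ?K"
      using K[of v] mult_left_mono[of "vec_l2norm v" 1 ?K] K0 by linarith
  qed
  fix v :: "complex vec" assume v: "v \<in> carrier_vec (dim_col B)"
  show "vec_l2norm (B *\<^sub>v v) \<le> mat_opnorm B * vec_l2norm v"
  proof (cases "vec_l2norm v = 0")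
    case True
    then show ?thesis
      using K[OF v] by simp
  next
    case False
    let ?w = "complex_of_real (1 / vec_l2norm v) \<cdot>\<^sub>v v"
    have "vec_l2norm ?w = 1" "?w \<in> carrier_vec (dim_col B)"
      using v False by (auto simp: vec_l2norm_smult norm_divide)
    then have "vec_l2norm (B *\<^sub>v ?w) \<le> mat_opnorm B"
      unfolding mat_opnorm_def by (intro cSup_upper[OF _ bdd]) force
    moreover have "B *\<^sub>v ?w = complex_of_real (1 / vec_l2norm v) \<cdot>\<^sub>v (B *\<^sub>v v)"
      using v by (intro mult_mat_vec) auto
    ultimately have "vec_l2norm (B *\<^sub>v v) / vec_l2norm v \<le> mat_opnorm B"
      by (simp add: vec_l2norm_smult norm_divide)
    moreover have "vec_l2norm v > 0"
      using False vec_l2norm_nonneg[of v] by linarith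
    ultimately show ?thesis
      by (simp add: divide_le_eq)
  qed
qed

lemma L2_set_sum_le:
  "finite L \<Longrightarrow> L2_set (\<lambda>s. \<Sum>l\<in>L. h l s) S \<le> (\<Sum>l\<in>L. L2_set (h l) S)"
proof (induction L rule: finite_induct)
  case (insert l L)
  then show ?case
    using L2_set_triangle_ineq[of "h l" "\<lambda>s. \<Sum>l\<in>L. h l s" S] by simp
qed (simp add: L2_set_0')

text \<open>The triangle inequality. Orthogonality of the summands would give the maximum instead of the sum,
  but it is lost once values at two different points are subtracted.\<close>

lemma l2_bounded_sum:
  assumes L: "finite L"
    and B: "\<And>l. l \<in> L \<Longrightarrow> B l \<in> carrier_mat R n \<and> l2_bounded (B l) c"
    and D: "D \<in> carrier_mat R n"
    and entries: "\<And>s t. s < R \<Longrightarrow> t < n \<Longrightarrow> D $$ (s, t) = (\<Sum>l\<in>L. B l $$ (s, t))"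
  shows "l2_bounded D (real (card L) * c)"
  unfolding l2_bounded_def
proof
  fix v :: "complex vec" assume "v \<in> carrier_vec (dim_col D)"
  then have v: "v \<in> carrier_vec n"
    using D by simp
  have "vec_l2norm (D *\<^sub>v v) = L2_set (\<lambda>s. cmod (\<Sum>l\<in>L. (B l *\<^sub>v v) $ s)) {..<R}"
  proof -
    have "(D *\<^sub>v v) $ s = (\<Sum>l\<in>L. (B l *\<^sub>v v) $ s)" if s: "s < R" for s
    proof -
      have "(D *\<^sub>v v) $ s = (\<Sum>t<n. \<Sum>l\<in>L. B l $$ (s, t) * v $ t)"
        using s v D by (subst mult_mat_vec_index) (auto simp: entries sum_distrib_right)
      also have "\<dots> = (\<Sum>l\<in>L. \<Sum>t<n. B l $$ (s, t) * v $ t)"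
        by (rule sum.swap)
      also have "\<dots> = (\<Sum>l\<in>L. (B l *\<^sub>v v) $ s)"
        using s v B by (intro sum.cong refl, subst mult_mat_vec_index) auto
      finally show ?thesis .
    qed
    then show ?thesis
      using D by (auto simp: vec_l2norm_eq_L2_set intro!: L2_set_cong)
  qed
  also have "\<dots> \<le> L2_set (\<lambda>s. \<Sum>l\<in>L. cmod ((B l *\<^sub>v v) $ s)) {..<R}"
    by (intro L2_set_mono norm_sum) auto
  also have "\<dots> \<le> (\<Sum>l\<in>L. L2_set (\<lambda>s. cmod ((B l *\<^sub>v v) $ s)) {..<R})"
    using L by (rule L2_set_sum_le)
  also have "\<dots> \<le> (\<Sum>l\<in>L. c * vec_l2norm v)"
  proof (rule sum_mono)
    fix l assume l: "l \<in> L"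
    then have "L2_set (\<lambda>s. cmod ((B l *\<^sub>v v) $ s)) {..<R} = vec_l2norm (B l *\<^sub>v v)"
      using B by (auto simp: vec_l2norm_eq_L2_set)
    then show "L2_set (\<lambda>s. cmod ((B l *\<^sub>v v) $ s)) {..<R} \<le> c * vec_l2norm v"
      using B[OF l] v unfolding l2_bounded_def by auto
  qed
  finally show "vec_l2norm (D *\<^sub>v v) \<le> real (card L) * c * vec_l2norm v"
    by simp
qed

lemma block_diag_carrier [simp]: "block_diag R r M off b \<in> carrier_mat R R"
  by (simp add: block_diag_def)

lemma block_diag_index:
  assumes "s < R" "t < R"
  shows "block_diag R r M off b $$ (s, t) = (\<Sum>m<M.
     if s \<in> {off m..<off m + r} \<and> t \<in> {off m..<off m + r} then b m $$ (s - off m, t - off m) else 0)"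
  using assms by (simp add: block_diag_def)

lemma disjoint_blocks_unique:
  assumes "disjoint_blocks R r M off" "m < M" "m' < M"
    and "s \<in> {off m..<off m + r}" "s \<in> {off m'..<off m' + r}"
  shows "m = m'"
  using assms unfolding disjoint_blocks_def by (metis atLeastLessThan_iff leD order_trans not_le)

lemma block_diag_row:
  assumes "disjoint_blocks R r M off" "m < M" "s < r" "t < R"
  shows "block_diag R r M off b $$ (off m + s, t) =
    (if t \<in> {off m..<off m + r} then b m $$ (s, t - off m) else 0)"
proof -
  have *: "off m + s \<in> {off m'..<off m' + r} \<longleftrightarrow> m' = m" if "m' < M" for m'
    using disjoint_blocks_unique[OF assms(1,2) that, of "off m + s"] assms(3) by auto
  have "off m + s < R"
    using assms by (auto simp: disjoint_blocks_def)
  then have "block_diag R r M off b $$ (off m + s, t) = (\<Sum>m'<M.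
     if off m + s \<in> {off m'..<off m' + r} \<and> t \<in> {off m'..<off m' + r}
     then b m' $$ (off m + s - off m', t - off m') else 0)"
    using assms(4) by (rule block_diag_index)
  also have "\<dots> = (\<Sum>m'<M. if m' = m then
      if t \<in> {off m..<off m + r} then b m $$ (s, t - off m) else 0 else 0)"
  proof (rule sum.cong[OF refl])
    fix m' assume "m' \<in> {..<M}"
    then show "(if off m + s \<in> {off m'..<off m' + r} \<and> t \<in> {off m'..<off m' + r}
        then b m' $$ (off m + s - off m', t - off m') else 0) =
      (if m' = m then if t \<in> {off m..<off m + r} then b m $$ (s, t - off m) else 0 else 0)"
      using *[of m'] by auto
  qed
  finally show ?thesis
    using assms(2) by simp
qed

lemma block_diag_diff:
  assumes "\<And>m. m < M \<Longrightarrow> b m \<in> carrier_mat r r" "\<And>m. m < M \<Longrightarrow> b' m \<in> carrier_mat r r"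
  shows "block_diag R r M off b - block_diag R r M off b' = block_diag R r M off (\<lambda>m. b m - b' m)"
proof (rule eq_matI)
  fix s t assume "s < dim_row (block_diag R r M off (\<lambda>m. b m - b' m))"
    "t < dim_col (block_diag R r M off (\<lambda>m. b m - b' m))"
  then have st: "s < R" "t < R"
    by (auto simp: block_diag_def)
  have "(b m - b' m) $$ (s - off m, t - off m) = b m $$ (s - off m, t - off m) - b' m $$ (s - off m, t - off m)"
    if "s \<in> {off m..<off m + r}" "t \<in> {off m..<off m + r}" "m < M" for m
    using that assms(2)[OF that(3)] by (subst index_minus_mat) auto
  then show "(block_diag R r M off b - block_diag R r M off b') $$ (s, t) =
      block_diag R r M off (\<lambda>m. b m - b' m) $$ (s, t)"
    using st carrier_matD[OF block_diag_carrier[of R r M off b']]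
    by (subst index_minus_mat)
      (auto simp: block_diag_index simp flip: sum_subtractf intro!: sum.cong)
qed (auto simp: block_diag_def)

definition block_part :: "nat \<Rightarrow> nat \<Rightarrow> complex vec \<Rightarrow> complex vec" where
  "block_part r k v = vec r (\<lambda>t. v $ (k + t))"

text \<open>Summation over disjoint blocks: nothing is counted twice, and nothing is lost if \<open>h\<close> vanishes off the
  blocks.\<close>

lemma block_sum:
  fixes h :: "nat \<Rightarrow> real"
  assumes blocks: "disjoint_blocks R r M off" and "\<And>s. 0 \<le> h s"
  shows "(\<Sum>m<M. \<Sum>s<r. h (off m + s)) \<le> (\<Sum>s<R. h s)"
    and "(\<And>s. s < R \<Longrightarrow> (\<And>m. m < M \<Longrightarrow> s \<notin> {off m..<off m + r}) \<Longrightarrow> h s = 0) \<Longrightarrow>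
      (\<Sum>m<M. \<Sum>s<r. h (off m + s)) = (\<Sum>s<R. h s)"
proof -
  let ?e = "\<lambda>(m, s). off m + s"
  have "inj_on ?e ({..<M} \<times> {..<r})"
  proof (rule inj_onI, clarsimp)
    fix m s m' s' assume "m < M" "s < r" "m' < M" "s' < r" and eq: "off m + s = off m' + s'"
    then have "m = m'"
      using disjoint_blocks_unique[OF blocks, of m m' "off m + s"] by auto
    then show "m = m' \<and> s = s'"
      using eq by simp
  qed
  then have sum: "(\<Sum>m<M. \<Sum>s<r. h (off m + s)) = sum h (?e ` ({..<M} \<times> {..<r}))"
    by (simp add: sum.cartesian_product sum.reindex case_prod_unfold)
  have sub: "?e ` ({..<M} \<times> {..<r}) \<subseteq> {..<R}"
    using blocks by (fastforce simp: disjoint_blocks_def)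
  show "(\<Sum>m<M. \<Sum>s<r. h (off m + s)) \<le> (\<Sum>s<R. h s)"
    unfolding sum using assms sub by (intro sum_mono2) auto
  assume zero: "\<And>s. s < R \<Longrightarrow> (\<And>m. m < M \<Longrightarrow> s \<notin> {off m..<off m + r}) \<Longrightarrow> h s = 0"
  show "(\<Sum>m<M. \<Sum>s<r. h (off m + s)) = (\<Sum>s<R. h s)"
    unfolding sum
  proof (rule sum.mono_neutral_left[OF _ sub], simp, rule ballI)
    fix s assume s: "s \<in> {..<R} - ?e ` ({..<M} \<times> {..<r})"
    show "h s = 0"
    proof (rule zero)
      fix m assume "m < M"
      show "s \<notin> {off m..<off m + r}"
      proof
        assume "s \<in> {off m..<off m + r}"
        then have "s = ?e (m, s - off m)" "(m, s - off m) \<in> {..<M} \<times> {..<r}"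
          using \<open>m < M\<close> by auto
        then show False
          using s by blast
      qed
    qed (use s in auto)
  qed
qed

text \<open>Pythagoras: a block diagonal matrix acts on the parts of the vector separately.\<close>

lemma block_diag_l2norm:
  assumes blocks: "disjoint_blocks R r M off"
    and b: "\<And>m. m < M \<Longrightarrow> b m \<in> carrier_mat r r" and v: "v \<in> carrier_vec R"
  shows "(vec_l2norm (block_diag R r M off b *\<^sub>v v))\<^sup>2 =
    (\<Sum>m<M. (vec_l2norm (b m *\<^sub>v block_part r (off m) v))\<^sup>2)"
proof -
  let ?D = "block_diag R r M off b"
  have D: "dim_row ?D = R" "dim_col ?D = R"
    by (auto simp: block_diag_def)
  have in_block: "(?D *\<^sub>v v) $ (off m + s) = (b m *\<^sub>v block_part r (off m) v) $ s"
    if m: "m < M" and s: "s < r" for m s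
  proof -
    have R: "off m + r \<le> R"
      using blocks m by (auto simp: disjoint_blocks_def)
    have "(?D *\<^sub>v v) $ (off m + s) =
        (\<Sum>t<R. (if t \<in> {off m..<off m + r} then b m $$ (s, t - off m) * v $ t else 0))"
      using m s v R D
      by (subst mult_mat_vec_index) (auto simp: block_diag_row[OF blocks m s] intro!: sum.cong)
    also have "\<dots> = (\<Sum>t\<in>{off m..<off m + r}. b m $$ (s, t - off m) * v $ t)"
      using R by (subst sum.inter_restrict[symmetric]) (auto intro!: sum.cong)
    also have "\<dots> = (\<Sum>t<r. b m $$ (s, t) * v $ (off m + t))"
      by (rule sum.reindex_bij_witness[of _ "\<lambda>t. off m + t" "\<lambda>t. t - off m"]) auto
    also have "\<dots> = (b m *\<^sub>v block_part r (off m) v) $ s"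
      using b[OF m] s by (subst mult_mat_vec_index) (auto simp: block_part_def)
    finally show ?thesis .
  qed
  have outside: "(?D *\<^sub>v v) $ s = 0"
    if s: "s < R" and "\<And>m. m < M \<Longrightarrow> s \<notin> {off m..<off m + r}" for s
  proof -
    have "?D $$ (s, t) = 0" if "t < R" for t
      using s that \<open>\<And>m. m < M \<Longrightarrow> s \<notin> {off m..<off m + r}\<close>
      by (subst block_diag_index) (auto intro!: sum.neutral)
    then show ?thesis
      using s v D by (subst mult_mat_vec_index) auto
  qed
  have "(vec_l2norm (?D *\<^sub>v v))\<^sup>2 = (\<Sum>s<R. (cmod ((?D *\<^sub>v v) $ s))\<^sup>2)"
    by (simp add: vec_l2norm_power2 D)
  also have "\<dots> = (\<Sum>m<M. \<Sum>s<r. (cmod ((?D *\<^sub>v v) $ (off m + s)))\<^sup>2)"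
    using outside by (intro block_sum(2)[OF blocks, symmetric]) auto
  also have "\<dots> = (\<Sum>m<M. (vec_l2norm (b m *\<^sub>v block_part r (off m) v))\<^sup>2)"
  proof (rule sum.cong[OF refl])
    fix m assume m: "m \<in> {..<M}"
    then have "dim_vec (b m *\<^sub>v block_part r (off m) v) = r"
      using b[of m] by auto
    then show "(\<Sum>s<r. (cmod ((?D *\<^sub>v v) $ (off m + s)))\<^sup>2) =
        (vec_l2norm (b m *\<^sub>v block_part r (off m) v))\<^sup>2"
      using m by (simp only: vec_l2norm_power2) (auto intro!: sum.cong simp only: in_block lessThan_iff)
  qed
  finally show ?thesis .
qed

lemma l2_bounded_block_diag:
  assumes blocks: "disjoint_blocks R r M off" and "0 \<le> c"
    and b: "\<And>m. m < M \<Longrightarrow> b m \<in> carrier_mat r r \<and> l2_bounded (b m) c"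
  shows "l2_bounded (block_diag R r M off b) c"
  unfolding l2_bounded_def
proof
  fix v :: "complex vec" assume "v \<in> carrier_vec (dim_col (block_diag R r M off b))"
  then have v: "v \<in> carrier_vec R"
    by (simp add: block_diag_def)
  have "(vec_l2norm (block_diag R r M off b *\<^sub>v v))\<^sup>2 =
      (\<Sum>m<M. (vec_l2norm (b m *\<^sub>v block_part r (off m) v))\<^sup>2)"
    using blocks b v by (intro block_diag_l2norm) auto
  also have "\<dots> \<le> (\<Sum>m<M. (c * vec_l2norm (block_part r (off m) v))\<^sup>2)"
  proof (intro sum_mono power_mono)
    fix m assume "m \<in> {..<M}"
    then show "vec_l2norm (b m *\<^sub>v block_part r (off m) v) \<le> c * vec_l2norm (block_part r (off m) v)"
      using b[of m] by (auto simp: l2_bounded_def block_part_def)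
  qed auto
  also have "\<dots> = c\<^sup>2 * (\<Sum>m<M. \<Sum>s<r. (cmod (v $ (off m + s)))\<^sup>2)"
    by (simp add: power_mult_distrib sum_distrib_left vec_l2norm_power2 block_part_def)
  also have "\<dots> \<le> c\<^sup>2 * (\<Sum>s<R. (cmod (v $ s))\<^sup>2)"
    by (intro mult_left_mono block_sum(1)[OF blocks]) auto
  also have "\<dots> = (c * vec_l2norm v)\<^sup>2"
    using v by (simp add: power_mult_distrib vec_l2norm_power2)
  finally show "vec_l2norm (block_diag R r M off b *\<^sub>v v) \<le> c * vec_l2norm v"
    using \<open>0 \<le> c\<close> by (auto intro: power2_le_imp_le)
qed

text \<open>Test the block diagonal matrix on vectors that are supported in one block.\<close>

lemma l2_bounded_block:
  assumes blocks: "disjoint_blocks R r M off"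
    and b: "\<And>m. m < M \<Longrightarrow> b m \<in> carrier_mat r r"
    and D: "l2_bounded (block_diag R r M off b) c" and "0 \<le> c" and m: "m < M"
  shows "l2_bounded (b m) c"
  unfolding l2_bounded_def
proof
  fix w :: "complex vec" assume "w \<in> carrier_vec (dim_col (b m))"
  then have w: "w \<in> carrier_vec r"
    using b[OF m] by simp
  define v where "v = vec R (\<lambda>t. if t \<in> {off m..<off m + r} then w $ (t - off m) else 0)"
  have v: "v \<in> carrier_vec R"
    by (simp add: v_def)
  have R: "off m' + r \<le> R" if "m' < M" for m'
    using blocks that by (auto simp: disjoint_blocks_def)
  have part: "block_part r (off m') v = (if m' = m then w else 0\<^sub>v r)" if "m' < M" for m'
  proof (rule eq_vecI)
    fix t assume "t < dim_vec (if m' = m then w else 0\<^sub>v r)"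
    then have t: "t < r"
      using w by (auto split: if_splits)
    have "off m' + t \<in> {off m..<off m + r} \<longleftrightarrow> m' = m"
      using disjoint_blocks_unique[OF blocks m that, of "off m' + t"] t by auto
    then show "block_part r (off m') v $ t = (if m' = m then w else 0\<^sub>v r) $ t"
      using t R[OF that] by (auto simp: block_part_def v_def)
  qed (use w in \<open>auto simp: block_part_def\<close>)
  have "(vec_l2norm v)\<^sup>2 = (\<Sum>m'<M. \<Sum>s<r. (cmod (v $ (off m' + s)))\<^sup>2)"
    using v m by (subst block_sum(2)[OF blocks]) (auto simp: vec_l2norm_power2 v_def)
  also have "\<dots> = (\<Sum>m'<M. (vec_l2norm (block_part r (off m') v))\<^sup>2)"
    by (simp add: vec_l2norm_power2 block_part_def)
  also have "\<dots> = (\<Sum>m'<M. if m' = m then (vec_l2norm w)\<^sup>2 else 0)"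
    by (intro sum.cong refl) (simp add: part)
  also have "\<dots> = (vec_l2norm w)\<^sup>2"
    using m by simp
  finally have norm_v: "vec_l2norm v = vec_l2norm w"
    by simp
  have "(vec_l2norm (b m *\<^sub>v w))\<^sup>2 = (vec_l2norm (b m *\<^sub>v block_part r (off m) v))\<^sup>2"
    using part[OF m] by simp
  also have "\<dots> \<le> (\<Sum>m'<M. (vec_l2norm (b m' *\<^sub>v block_part r (off m') v))\<^sup>2)"
    using m by (intro member_le_sum) auto
  also have "\<dots> = (vec_l2norm (block_diag R r M off b *\<^sub>v v))\<^sup>2"
    using block_diag_l2norm[OF blocks b v] by simp
  finally have "vec_l2norm (b m *\<^sub>v w) \<le> vec_l2norm (block_diag R r M off b *\<^sub>v v)"
    by (rule power2_le_imp_le) simp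
  also have "\<dots> \<le> c * vec_l2norm v"
    using D v by (auto simp: l2_bounded_def block_diag_def)
  finally show "vec_l2norm (b m *\<^sub>v w) \<le> c * vec_l2norm w"
    by (simp add: norm_v)
qed


section \<open>Elements and homomorphisms of direct sums of homogeneous algebras\<close>

lemma homog_sumD:
  assumes "homog_sum B" "l < num B"
  shows "topspace (base B l) \<noteq> {}" "compact_space (base B l)" "Hausdorff_space (base B l)"
    "0 < prank B l" "mat_continuous (base B l) (msize B l) (proj B l)"
    and "x \<in> topspace (base B l) \<Longrightarrow> proj B l x \<in> carrier_mat (msize B l) (msize B l)"
    and "x \<in> topspace (base B l) \<Longrightarrow> proj B l x * proj B l x = proj B l x"
    and "x \<in> topspace (base B l) \<Longrightarrow> vec_space.rank (msize B l) (proj B l x) = prank B l"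
  using assms by (auto simp: homog_sum_def mat_continuous_def)

lemma trace_proj:
  assumes "homog_sum B" "l < num B" "x \<in> topspace (base B l)"
  shows "(\<Sum>s<msize B l. proj B l x $$ (s, s)) = of_nat (prank B l)"
  using vec_space.trace_idempotent_eq_rank[OF homog_sumD(6,7)[OF assms]] homog_sumD(8)[OF assms]
  by simp

lemma proj_diagonal_nonzero:
  assumes "homog_sum B" "l < num B" "x \<in> topspace (base B l)"
  obtains s where "s < msize B l" "proj B l x $$ (s, s) \<noteq> 0"
proof -
  have "(\<Sum>s<msize B l. proj B l x $$ (s, s)) \<noteq> 0"
    using trace_proj[OF assms] homog_sumD(4)[OF assms(1,2)] by simp
  then show ?thesis
    using that by (meson sum.not_neutral_contains_not_neutral lessThan_iff)
qed

lemma proj_fixed_vector: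
  assumes B: "homog_sum B" "l < num B" "x \<in> topspace (base B l)"
  obtains w where "w \<in> carrier_vec (msize B l)" "proj B l x *\<^sub>v w = w" "0 < vec_l2norm w"
proof -
  let ?p = "proj B l x"
  obtain s where s: "s < msize B l" "?p $$ (s, s) \<noteq> 0"
    using proj_diagonal_nonzero[OF B] .
  have p: "?p \<in> carrier_mat (msize B l) (msize B l)"
    using homog_sumD(6)[OF B] .
  let ?w = "col ?p s"
  have w: "?w \<in> carrier_vec (msize B l)"
    using col_dim[of ?p s] carrier_matD(1)[OF p] by simp
  have "?p *\<^sub>v ?w = col (?p * ?p) s"
    using p s by (intro col_mult2[symmetric]) auto
  also have "\<dots> = ?w"
    using homog_sumD(7)[OF B] by simp
  finally have "?p *\<^sub>v ?w = ?w" .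
  moreover have "0 < vec_l2norm ?w"
  proof -
    have "0 < cmod (?w $ s)"
      using p s by auto
    also have "\<dots> \<le> vec_l2norm ?w"
      using s p unfolding vec_l2norm_eq_L2_set by (intro member_le_L2_set) auto
    finally show ?thesis .
  qed
  ultimately show ?thesis
    using that w by blast
qed

lemma summand_carrier:
  "f \<in> summand B l \<Longrightarrow> x \<in> topspace (base B l) \<Longrightarrow> f x \<in> carrier_mat (msize B l) (msize B l)"
  by (auto simp: summand_def mat_continuous_def)

lemma alg_carrier:
  "f \<in> alg B \<Longrightarrow> l < num B \<Longrightarrow> x \<in> topspace (base B l) \<Longrightarrow>
    f l x \<in> carrier_mat (msize B l) (msize B l)"
  using summand_carrier[of "f l" B l x] by (auto simp: alg_def)

definition scaled_proj :: "'a homog_sum \<Rightarrow> nat \<Rightarrow> ('a \<Rightarrow> real) \<Rightarrow> 'a \<Rightarrow> complex mat" where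
  "scaled_proj B l g = (\<lambda>x\<in>topspace (base B l). complex_of_real (g x) \<cdot>\<^sub>m proj B l x)"

lemma scaled_proj_in_summand:
  assumes B: "homog_sum B" "l < num B" and g: "continuous_map (base B l) euclideanreal g"
  shows "scaled_proj B l g \<in> summand B l"
proof -
  let ?X = "base B l" and ?r = "msize B l" and ?p = "proj B l"
  have p: "?p x \<in> carrier_mat ?r ?r" "?p x * ?p x = ?p x" if "x \<in> topspace ?X" for x
    using homog_sumD(6,7)[OF B that] by auto
  have "continuous_map ?X euclidean (\<lambda>x. scaled_proj B l g x $$ (s, t))" if st: "s < ?r" "t < ?r" for s t
  proof -
    have "continuous_map ?X euclidean (\<lambda>x. ?p x $$ (s, t))"
      using homog_sumD(5)[OF B] st by (simp add: mat_continuous_def)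
    then have "continuous_map ?X euclidean (\<lambda>x. complex_of_real (g x) * ?p x $$ (s, t))"
      using g by (auto simp: continuous_map_atin intro!: tendsto_intros)
    then show ?thesis
      using st carrier_matD[OF p(1)] by (elim continuous_map_eq) (simp add: scaled_proj_def)
  qed
  moreover have "?p x * scaled_proj B l g x * ?p x = scaled_proj B l g x" if x: "x \<in> topspace ?X" for x
    using p[OF x] x by (simp add: scaled_proj_def mult_smult_distrib[of _ ?r ?r _ ?r]
        mult_smult_assoc_mat[of _ ?r ?r _ ?r])
  ultimately show ?thesis
    using p by (auto simp: summand_def mat_continuous_def scaled_proj_def)
qed

lemma zero_in_summand:
  assumes "homog_sum B" "l < num B"
  shows "(\<lambda>x\<in>topspace (base B l). 0\<^sub>m (msize B l) (msize B l)) \<in> summand B l"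
proof -
  have "continuous_map (base B l) euclidean
      (\<lambda>x. (\<lambda>x\<in>topspace (base B l). 0\<^sub>m (msize B l) (msize B l) :: complex mat) x $$ (s, t))"
    if "s < msize B l" "t < msize B l" for s t
    by (rule continuous_map_eq[of _ _ "\<lambda>_. 0"]) (use that in auto)
  moreover have "proj B l x * 0\<^sub>m (msize B l) (msize B l) * proj B l x = 0\<^sub>m (msize B l) (msize B l)"
    if "x \<in> topspace (base B l)" for x
    using homog_sumD(6)[OF assms that] by simp
  ultimately show ?thesis
    by (auto simp: summand_def mat_continuous_def)
qed

lemma proj_in_summand:
  assumes "homog_sum B" "l < num B"
  shows "restrict (proj B l) (topspace (base B l)) \<in> summand B l"
proof -
  have "1 \<cdot>\<^sub>m b = b" for b :: "complex mat"
    by (rule eq_matI) auto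
  then have "scaled_proj B l (\<lambda>_. 1) = restrict (proj B l) (topspace (base B l))"
    by (simp add: scaled_proj_def)
  then show ?thesis
    using scaled_proj_in_summand[OF assms, of "\<lambda>_. 1"] by simp
qed

lemma alg_unit_in_alg: "homog_sum B \<Longrightarrow> alg_unit B \<in> alg B"
  using proj_in_summand by (auto simp: alg_unit_def alg_def pointwise1_def)

text \<open>The part of \<open>f\<close> in the first \<open>n\<close> summands. It allows to write \<open>f\<close> as the sum of its components
  by induction, using only sums of two elements.\<close>

definition truncation :: "'a homog_sum \<Rightarrow> nat \<Rightarrow> 'a elem \<Rightarrow> 'a elem" where
  "truncation B n f = (\<lambda>l\<in>{..<num B}. \<lambda>x\<in>topspace (base B l).
     if l < n then f l x else 0\<^sub>m (msize B l) (msize B l))"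

lemma restrict_summand: "f \<in> summand B l \<Longrightarrow> restrict f (topspace (base B l)) = f"
  by (auto simp: summand_def extensional_restrict)

lemma truncation_in_alg:
  assumes "homog_sum B" "f \<in> alg B"
  shows "truncation B n f \<in> alg B"
proof -
  have "(\<lambda>x\<in>topspace (base B l). if l < n then f l x else 0\<^sub>m (msize B l) (msize B l)) \<in> summand B l"
    if l: "l < num B" for l
  proof -
    have "f l \<in> summand B l"
      using assms(2) l by (auto simp: alg_def)
    then show ?thesis
      using zero_in_summand[OF assms(1) l] restrict_summand[of "f l" B l] by (cases "l < n") auto
  qed
  then show ?thesis
    by (auto simp: alg_def truncation_def)
qed

lemma summand_incl_in_alg:
  assumes "homog_sum B" "l < num B" "f \<in> summand B l"
  shows "summand_incl B l f \<in> alg B"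
proof -
  have "(\<lambda>x\<in>topspace (base B l'). if l' = l then f x else 0\<^sub>m (msize B l') (msize B l')) \<in> summand B l'"
    if "l' < num B" for l'
    using zero_in_summand[OF assms(1) that] restrict_summand[OF assms(3)] assms(3)
    by (cases "l' = l") auto
  then show ?thesis
    by (auto simp: alg_def summand_incl_def)
qed

lemma truncation_all:
  assumes "f \<in> alg B"
  shows "truncation B (num B) f = f"
proof (rule ext)
  fix l
  show "truncation B (num B) f l = f l"
  proof (cases "l < num B")
    case True
    then have "f l \<in> summand B l"
      using assms by (auto simp: alg_def)
    then have "restrict (f l) (topspace (base B l)) = f l"
      by (rule restrict_summand)
    then show ?thesis
      using True by (simp add: truncation_def)
  next
    case False
    then show ?thesis
      using assms by (auto simp: truncation_def alg_def PiE_def extensional_def)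
  qed
qed

lemma truncation_0: "f \<in> alg B \<Longrightarrow> pointwise1 B (\<lambda>b. 0 \<cdot>\<^sub>m b) f = truncation B 0 f"
  using alg_carrier by (fastforce simp: truncation_def pointwise1_def intro!: restrict_ext)

lemma truncation_Suc:
  assumes "f \<in> alg B"
  shows "pointwise2 B (+) (truncation B n f) (summand_incl B n (f n)) = truncation B (Suc n) f"
  unfolding truncation_def pointwise2_def
proof (intro restrict_ext)
  fix l x assume "l \<in> {..<num B}" "x \<in> topspace (base B l)"
  moreover from this have "f l x \<in> carrier_mat (msize B l) (msize B l)"
    using alg_carrier[OF assms] by auto
  ultimately show "(\<lambda>l\<in>{..<num B}. \<lambda>x\<in>topspace (base B l). if l < n then f l x else 0\<^sub>m (msize B l) (msize B l)) l x +
      summand_incl B n (f n) l x = (if l < Suc n then f l x else 0\<^sub>m (msize B l) (msize B l))"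
    by (auto simp: summand_incl_def less_Suc_eq)
qed

text \<open>A homomorphism is determined by its restrictions to the summands, being additive.\<close>

lemma hom_entry_eq_sum:
  assumes B: "homog_sum B" and \<psi>: "unital_star_hom B C \<psi>" and f: "f \<in> alg B"
    and k: "k < num C" and y: "y \<in> topspace (base C k)" and st: "s < msize C k" "t < msize C k"
  shows "\<psi> f k y $$ (s, t) = (\<Sum>l<num B. \<psi> (summand_incl B l (f l)) k y $$ (s, t))"
proof -
  have into: "\<psi> g \<in> alg C" if "g \<in> alg B" for g
    using \<psi> that by (auto simp: unital_star_hom_def)
  have *: "\<psi> (truncation B n f) k y $$ (s, t) = (\<Sum>l<n. \<psi> (summand_incl B l (f l)) k y $$ (s, t))"
    if "n \<le> num B" for n
    using that
  proof (induction n)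
    case 0
    have "\<psi> (truncation B 0 f) = pointwise1 C (\<lambda>b. 0 \<cdot>\<^sub>m b) (\<psi> f)"
      using \<psi> f by (simp add: unital_star_hom_def flip: truncation_0)
    then show ?case
      using alg_carrier[OF into[OF f] k y] k y st by (auto simp: pointwise1_def)
  next
    case (Suc n)
    have "n < num B"
      using Suc.prems by simp
    moreover from this have "f n \<in> summand B n"
      using f by (auto simp: alg_def)
    ultimately have g: "truncation B n f \<in> alg B" "summand_incl B n (f n) \<in> alg B"
      using truncation_in_alg[OF B f] summand_incl_in_alg[OF B] by blast+
    then have "\<psi> (truncation B (Suc n) f) =
        pointwise2 C (+) (\<psi> (truncation B n f)) (\<psi> (summand_incl B n (f n)))"
      using \<psi> by (simp add: unital_star_hom_def flip: truncation_Suc[OF f])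
    then show ?case
      using Suc k y st alg_carrier[OF into[OF g(1)] k y] alg_carrier[OF into[OF g(2)] k y]
      by (auto simp: pointwise2_def)
  qed
  then show ?thesis
    using *[OF order_refl] by (simp only: truncation_all[OF f])
qed

lemma unital_star_hom_comp:
  "unital_star_hom B C \<psi> \<Longrightarrow> unital_star_hom C E \<theta> \<Longrightarrow> unital_star_hom B E (\<theta> \<circ> \<psi>)"
  by (simp add: unital_star_hom_def Pi_iff)

lemma unital_star_hom_conn:
  assumes "\<And>i. unital_star_hom (A i) (A (Suc i)) (\<phi> i)" "i \<le> j"
  shows "unital_star_hom (A i) (A j) (conn \<phi> i j)"
  using assms(2)
proof (induction rule: dec_induct)
  case base
  then show ?case
    by (simp add: conn_def unital_star_hom_def)
next
  case (step j)
  have "conn \<phi> i (Suc j) = \<phi> j \<circ> conn \<phi> i j"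
    using step.hyps by (simp add: conn_def fun_eq_iff)
  then show ?case
    using unital_star_hom_comp[OF step.IH assms(1)] by (simp only:)
qed

lemma conn_comp:
  assumes "i \<le> j" "j \<le> k"
  shows "conn \<phi> i k = conn \<phi> j k \<circ> conn \<phi> i j"
proof -
  have "[i..<k] = [i..<j] @ [j..<k]"
    using assms by (metis le_add_diff_inverse upt_add_eq_append)
  then show ?thesis
    by (simp add: conn_def fun_eq_iff)
qed


section \<open>Diagonal maps\<close>

text \<open>The diagonal of a matrix as a generating polynomial. Moving a block by \<open>off\<close> along the diagonal becomes
  multiplication by \<open>z\<^bsup>off\<^esup>\<close>, and evaluation at \<open>1\<close> becomes the trace.\<close>

definition diag_poly :: "nat \<Rightarrow> complex mat \<Rightarrow> complex poly" where
  "diag_poly n b = (\<Sum>s<n. monom (b $$ (s, s)) s)"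

lemma coeff_diag_poly: "coeff (diag_poly n b) s = (if s < n then b $$ (s, s) else 0)"
  by (simp add: diag_poly_def coeff_sum)

lemma poly_diag_poly_1: "poly (diag_poly n b) 1 = (\<Sum>s<n. b $$ (s, s))"
  by (simp add: diag_poly_def poly_sum poly_monom)

lemma diag_poly_block_diag:
  assumes "disjoint_blocks R r M off"
  shows "diag_poly R (block_diag R r M off b) = (\<Sum>m<M. monom 1 (off m) * diag_poly r (b m))"
proof (rule poly_eqI)
  fix s
  have "coeff (\<Sum>m<M. monom 1 (off m) * diag_poly r (b m)) s =
      (\<Sum>m<M. if s \<in> {off m..<off m + r} then b m $$ (s - off m, s - off m) else 0)"
    by (auto simp: coeff_sum coeff_monom_mult coeff_diag_poly intro!: sum.cong)
  also have "\<dots> = (if s < R then block_diag R r M off b $$ (s, s) else 0)"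
  proof (cases "s < R")
    case True
    then show ?thesis
      by (simp add: block_diag_index)
  next
    case False
    then show ?thesis
      using assms by (force simp: disjoint_blocks_def intro!: sum.neutral)
  qed
  finally show "coeff (diag_poly R (block_diag R r M off b)) s =
      coeff (\<Sum>m<M. monom 1 (off m) * diag_poly r (b m)) s"
    by (simp add: coeff_diag_poly)
qed

lemma diag_poly_hom:
  assumes "homog_sum B" "unital_star_hom B C \<psi>" "f \<in> alg B" "k < num C" "y \<in> topspace (base C k)"
  shows "diag_poly (msize C k) (\<psi> f k y) =
    (\<Sum>l<num B. diag_poly (msize C k) (\<psi> (summand_incl B l (f l)) k y))"
  using hom_entry_eq_sum[OF assms] by (intro poly_eqI) (simp add: coeff_diag_poly coeff_sum)

text \<open>The trace of the image of the unit, computed in two ways.\<close>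

lemma diagonal_hom_rank:
  assumes B: "homog_sum B" and C: "homog_sum C" and \<psi>: "unital_star_hom B C \<psi>" and k: "k < num C"
    and diag: "\<And>l. l < num B \<Longrightarrow> diagonal_component B C \<psi> l k (M l) (\<Lambda> l)"
  shows "(\<Sum>l<num B. M l * prank B l) = prank C k"
proof -
  obtain y where y: "y \<in> topspace (base C k)"
    using homog_sumD(1)[OF C k] by blast
  have unit: "alg_unit B l = restrict (proj B l) (topspace (base B l))" if "l < num B" for l
    using that by (simp add: alg_unit_def pointwise1_def restrict_def)
  have "complex_of_nat (prank C k) = poly (diag_poly (msize C k) (\<psi> (alg_unit B) k y)) 1"
    using \<psi> k y trace_proj[OF C k y]
    by (simp add: poly_diag_poly_1 unital_star_hom_def alg_unit_def pointwise1_def)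
  also have "\<dots> = (\<Sum>l<num B. poly (diag_poly (msize C k) (\<psi> (summand_incl B l (alg_unit B l)) k y)) 1)"
    using diag_poly_hom[OF B \<psi> alg_unit_in_alg[OF B] k y] by (simp add: poly_sum)
  also have "\<dots> = (\<Sum>l<num B. of_nat (M l * prank B l))"
  proof (rule sum.cong[OF refl])
    fix l assume "l \<in> {..<num B}"
    then have l: "l < num B"
      by simp
    obtain off where off: "disjoint_blocks (msize C k) (msize B l) (M l) off"
      "\<And>f y. f \<in> summand B l \<Longrightarrow> y \<in> topspace (base C k) \<Longrightarrow> \<psi> (summand_incl B l f) k y =
         block_diag (msize C k) (msize B l) (M l) off (\<lambda>m. f (\<Lambda> l m y))"
      using diag[OF l] unfolding diagonal_component_def by blast
    have "\<Lambda> l m y \<in> topspace (base B l)" if "m < M l" for m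
      using diag[OF l] that y by (auto simp: diagonal_component_def continuous_map_def)
    then have "poly (diag_poly (msize B l) (alg_unit B l (\<Lambda> l m y))) 1 = of_nat (prank B l)"
      if "m < M l" for m
      using that trace_proj[OF B l] by (simp add: poly_diag_poly_1 unit[OF l])
    then show "poly (diag_poly (msize C k) (\<psi> (summand_incl B l (alg_unit B l)) k y)) 1 =
        of_nat (M l * prank B l)"
      using off(2)[OF _ y, of "alg_unit B l"] proj_in_summand[OF B l] unit[OF l]
      by (simp add: diag_poly_block_diag[OF off(1)] poly_sum poly_monom)
  qed
  finally have "complex_of_nat (\<Sum>l<num B. M l * prank B l) = of_nat (prank C k)"
    by simp
  then show ?thesis
    by (simp only: of_nat_eq_iff)
qed

lemma bump_at_point:
  assumes X: "compact_space X" "Hausdorff_space X" and x: "x \<in> topspace X"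
    and P: "finite P" "P \<subseteq> topspace X"
  obtains g :: "'a \<Rightarrow> real" where "continuous_map X euclideanreal g"
    "\<And>z. z \<in> P \<Longrightarrow> g z = (if z = x then 1 else 0)"
proof -
  have "normal_space X"
    using X compact_Hausdorff_or_regular_imp_normal_space by blast
  moreover have "closedin X (P - {x})"
    using P X(2) by (metis Diff_subset Hausdorff_imp_t1_space finite_Diff order_trans t1_space_closedin_finite)
  moreover have "closedin X {x}"
    using x X(2) by (simp add: closedin_Hausdorff_singleton)
  moreover have "disjnt (P - {x}) {x}"
    by auto
  ultimately obtain g where "continuous_map X euclideanreal g" "g ` (P - {x}) \<subseteq> {0::real}" "g ` {x} \<subseteq> {1}"
    by (rule Urysohn_lemma_alt)
  moreover from this have "g z = (if z = x then 1 else 0)" if "z \<in> P" for z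
    using that by auto
  ultimately show ?thesis
    using that by blast
qed

text \<open>The composite of two diagonal homomorphisms consists of the blocks with eigenvalue maps \<open>\<Gamma> c\<close>, where
  \<open>c\<close> runs through the pairs of consecutive eigenvalue maps, at positions \<open>pos c\<close>. A second diagonal form of the
  same homomorphism is given by \<open>\<Lambda>\<close> and \<open>off\<close>. A priori only the unordered collections of the points \<open>\<Lambda> m y\<close>
  and \<open>\<Gamma> c y\<close> agree at every \<open>y\<close>, and the matching might jump as \<open>y\<close> varies; moreover blocks
  that pass through different summands of \<open>C\<close> may overlap.

  Positions settle this. Apply both forms to \<open>g p\<close>, where \<open>g\<close> is a bump function that isolates the point
  \<open>x\<close> from the other finitely many points involved. The generating polynomials of the diagonals give
  \<open>(\<Sum> z\<^bsup>off m\<^esup>) Q = (\<Sum> z\<^bsup>pos c\<^esup>) Q\<close>, where \<open>m\<close> and \<open>c\<close> range over the indices with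
  \<open>\<Lambda> m y = x\<close> and \<open>\<Gamma> c y = x\<close>, and \<open>Q \<noteq> 0\<close> comes from the diagonal of \<open>p (x)\<close>. Cancelling \<open>Q\<close> shows that at every
  point \<open>x\<close> the same positions occur on both sides. As the positions \<open>off\<close> are distinct, exactly
  one \<open>c\<close> has the position of a given \<open>m\<close>, for all \<open>y\<close> at once.\<close>

lemma diagonal_maps_compose:
  assumes B: "homog_sum B" and C: "homog_sum C" and E: "homog_sum E"
    and \<psi>: "unital_star_hom B C \<psi>" and \<theta>: "unital_star_hom C E \<theta>"
    and l: "l < num B" and k: "k < num E"
    and diag1: "\<And>h. h < num C \<Longrightarrow> diagonal_component B C \<psi> l h (M1 h) (\<Lambda>1 h)"
    and diag2: "\<And>h. h < num C \<Longrightarrow> diagonal_component C E \<theta> h k (M2 h) (\<Lambda>2 h)"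
    and diag: "diagonal_component B E (\<theta> \<circ> \<psi>) l k M \<Lambda>"
    and m: "m < M"
  shows "\<exists>h<num C. \<exists>b<M2 h. \<exists>a<M1 h. \<forall>y\<in>topspace (base E k). \<Lambda> m y = \<Lambda>1 h a (\<Lambda>2 h b y)"
proof -
  let ?X = "base B l" and ?Y = "base E k" and ?r = "msize B l" and ?R = "msize E k"
  obtain off where off: "disjoint_blocks ?R ?r M off"
      "\<And>f y. f \<in> summand B l \<Longrightarrow> y \<in> topspace ?Y \<Longrightarrow>
        (\<theta> \<circ> \<psi>) (summand_incl B l f) k y = block_diag ?R ?r M off (\<lambda>m. f (\<Lambda> m y))"
    using diag unfolding diagonal_component_def by blast
  have "\<forall>h\<in>{..<num C}. \<exists>off1. disjoint_blocks (msize C h) ?r (M1 h) off1 \<and>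
      (\<forall>f\<in>summand B l. \<forall>z\<in>topspace (base C h). \<psi> (summand_incl B l f) h z =
        block_diag (msize C h) ?r (M1 h) off1 (\<lambda>m. f (\<Lambda>1 h m z)))"
    using diag1 unfolding diagonal_component_def by blast
  then obtain off1 where off1: "\<And>h. h < num C \<Longrightarrow> disjoint_blocks (msize C h) ?r (M1 h) (off1 h)"
      "\<And>h f z. h < num C \<Longrightarrow> f \<in> summand B l \<Longrightarrow> z \<in> topspace (base C h) \<Longrightarrow>
        \<psi> (summand_incl B l f) h z =
        block_diag (msize C h) ?r (M1 h) (off1 h) (\<lambda>m. f (\<Lambda>1 h m z))"
    by (auto dest!: bchoice)
  have "\<forall>h\<in>{..<num C}. \<exists>off2. disjoint_blocks ?R (msize C h) (M2 h) off2 \<and>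
      (\<forall>f\<in>summand C h. \<forall>y\<in>topspace ?Y. \<theta> (summand_incl C h f) k y =
        block_diag ?R (msize C h) (M2 h) off2 (\<lambda>m. f (\<Lambda>2 h m y)))"
    using diag2 unfolding diagonal_component_def by blast
  then obtain off2 where off2: "\<And>h. h < num C \<Longrightarrow> disjoint_blocks ?R (msize C h) (M2 h) (off2 h)"
      "\<And>h f y. h < num C \<Longrightarrow> f \<in> summand C h \<Longrightarrow> y \<in> topspace ?Y \<Longrightarrow>
        \<theta> (summand_incl C h f) k y =
        block_diag ?R (msize C h) (M2 h) (off2 h) (\<lambda>m. f (\<Lambda>2 h m y))"
    by (auto dest!: bchoice)
  have \<Lambda>: "\<Lambda> m y \<in> topspace ?X" if "m < M" "y \<in> topspace ?Y" for m y
    using diag that by (auto simp: diagonal_component_def continuous_map_def)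
  have \<Lambda>1: "\<Lambda>1 h a z \<in> topspace ?X" if "h < num C" "a < M1 h" "z \<in> topspace (base C h)" for h a z
    using diag1[OF that(1)] that by (auto simp: diagonal_component_def continuous_map_def)
  have \<Lambda>2: "\<Lambda>2 h b y \<in> topspace (base C h)" if "h < num C" "b < M2 h" "y \<in> topspace ?Y" for h b y
    using diag2[OF that(1)] that by (auto simp: diagonal_component_def continuous_map_def)
  define J where "J = (SIGMA h:{..<num C}. {..<M2 h} \<times> {..<M1 h})"
  define pos where "pos = (\<lambda>(h, b, a). off2 h b + off1 h a)"
  define \<Gamma> where "\<Gamma> = (\<lambda>(h, b, a) y. \<Lambda>1 h a (\<Lambda>2 h b y))"
  have finJ: "finite J"
    by (simp add: J_def)
  have \<Gamma>: "\<Gamma> c y \<in> topspace ?X" if "c \<in> J" "y \<in> topspace ?Y" for c y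
    using that \<Lambda>1 \<Lambda>2 by (auto simp: J_def \<Gamma>_def)
  have polys: "(\<Sum>m<M. monom 1 (off m) * diag_poly ?r (f (\<Lambda> m y))) =
      (\<Sum>c\<in>J. monom 1 (pos c) * diag_poly ?r (f (\<Gamma> c y)))"
    if f: "f \<in> summand B l" and y: "y \<in> topspace ?Y" for f y
  proof -
    let ?g = "\<psi> (summand_incl B l f)"
    have g: "?g \<in> alg C"
      using \<psi> summand_incl_in_alg[OF B l f] by (auto simp: unital_star_hom_def)
    have "(\<Sum>m<M. monom 1 (off m) * diag_poly ?r (f (\<Lambda> m y))) = diag_poly ?R (\<theta> ?g k y)"
      using off(2)[OF f y] by (simp add: diag_poly_block_diag[OF off(1)])
    also have "\<dots> = (\<Sum>h<num C. diag_poly ?R (\<theta> (summand_incl C h (?g h)) k y))"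
      by (rule diag_poly_hom[OF C \<theta> g k y])
    also have "\<dots> = (\<Sum>h<num C. \<Sum>b<M2 h. \<Sum>a<M1 h.
        monom 1 (off2 h b + off1 h a) * diag_poly ?r (f (\<Lambda>1 h a (\<Lambda>2 h b y))))"
    proof (rule sum.cong[OF refl])
      fix h assume "h \<in> {..<num C}"
      then have h: "h < num C"
        by simp
      then have "?g h \<in> summand C h"
        using g by (auto simp: alg_def)
      then have "diag_poly ?R (\<theta> (summand_incl C h (?g h)) k y) =
          (\<Sum>b<M2 h. monom 1 (off2 h b) * diag_poly (msize C h) (?g h (\<Lambda>2 h b y)))"
        using h y by (simp add: off2(2) diag_poly_block_diag[OF off2(1)])
      also have "\<dots> = (\<Sum>b<M2 h. \<Sum>a<M1 h.
          monom 1 (off2 h b + off1 h a) * diag_poly ?r (f (\<Lambda>1 h a (\<Lambda>2 h b y))))"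
        using h y f by (intro sum.cong refl)
          (simp add: off1(2) \<Lambda>2 diag_poly_block_diag[OF off1(1)] sum_distrib_left mult_monom
            flip: mult.assoc)
      finally show "diag_poly ?R (\<theta> (summand_incl C h (?g h)) k y) = (\<Sum>b<M2 h. \<Sum>a<M1 h.
          monom 1 (off2 h b + off1 h a) * diag_poly ?r (f (\<Lambda>1 h a (\<Lambda>2 h b y))))" .
    qed
    also have "\<dots> = (\<Sum>c\<in>J. monom 1 (pos c) * diag_poly ?r (f (\<Gamma> c y)))"
      unfolding J_def pos_def \<Gamma>_def
      by (simp add: sum.Sigma sum.cartesian_product split_beta)
    finally show ?thesis .
  qed
  have count: "card {m \<in> {..<M}. \<Lambda> m y = x \<and> off m = q} = card {c \<in> J. \<Gamma> c y = x \<and> pos c = q}"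
    if x: "x \<in> topspace ?X" and y: "y \<in> topspace ?Y" for x y q
  proof -
    let ?P = "(\<lambda>m. \<Lambda> m y) ` {..<M} \<union> (\<lambda>c. \<Gamma> c y) ` J"
    obtain g where g: "continuous_map ?X euclideanreal g"
        "\<And>z. z \<in> ?P \<Longrightarrow> g z = (if z = x then 1 else 0)"
    proof (rule bump_at_point[OF homog_sumD(2,3)[OF B l] x])
      show "finite ?P"
        using finJ by simp
      show "?P \<subseteq> topspace ?X"
        using \<Lambda> \<Gamma> y by auto
    qed blast
    let ?Q = "diag_poly ?r (proj B l x)"
    have Q: "diag_poly ?r (scaled_proj B l g z) = (if z = x then ?Q else 0)" if "z \<in> ?P" for z
    proof -
      have z: "z \<in> topspace ?X"
        using that \<Lambda> \<Gamma> y by auto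
      show ?thesis
        using g(2)[OF that] z homog_sumD(6)[OF B l z]
        by (intro poly_eqI) (auto simp: coeff_diag_poly scaled_proj_def)
    qed
    have "?Q \<noteq> 0"
    proof -
      obtain s where "s < ?r" "proj B l x $$ (s, s) \<noteq> 0"
        using proj_diagonal_nonzero[OF B l x] .
      then have "coeff ?Q s \<noteq> 0"
        by (simp add: coeff_diag_poly)
      then show ?thesis
        by auto
    qed
    moreover have "(\<Sum>m<M. if \<Lambda> m y = x then monom 1 (off m) else 0) * ?Q =
        (\<Sum>c\<in>J. if \<Gamma> c y = x then monom 1 (pos c) else 0) * ?Q"
    proof -
      have "(\<Sum>m<M. if \<Lambda> m y = x then monom 1 (off m) else 0) * ?Q =
          (\<Sum>m<M. monom 1 (off m) * diag_poly ?r (scaled_proj B l g (\<Lambda> m y)))"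
        by (auto simp: sum_distrib_right Q intro!: sum.cong)
      also have "\<dots> = (\<Sum>c\<in>J. monom 1 (pos c) * diag_poly ?r (scaled_proj B l g (\<Gamma> c y)))"
        by (rule polys[OF scaled_proj_in_summand[OF B l g(1)] y])
      also have "\<dots> = (\<Sum>c\<in>J. if \<Gamma> c y = x then monom 1 (pos c) else 0) * ?Q"
        by (auto simp: sum_distrib_right Q intro!: sum.cong)
      finally show ?thesis .
    qed
    ultimately have "(\<Sum>m<M. if \<Lambda> m y = x then monom (1::complex) (off m) else 0) =
        (\<Sum>c\<in>J. if \<Gamma> c y = x then monom 1 (pos c) else 0)"
      by simp
    then have "coeff (\<Sum>m<M. if \<Lambda> m y = x then monom (1::complex) (off m) else 0) q =
        coeff (\<Sum>c\<in>J. if \<Gamma> c y = x then monom 1 (pos c) else 0) q"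
      by simp
    moreover have "coeff (\<Sum>m<M. if \<Lambda> m y = x then monom (1::complex) (off m) else 0) q =
        (\<Sum>m<M. if \<Lambda> m y = x \<and> off m = q then 1 else 0)"
      by (auto simp: coeff_sum intro!: sum.cong)
    moreover have "coeff (\<Sum>c\<in>J. if \<Gamma> c y = x then monom (1::complex) (pos c) else 0) q =
        (\<Sum>c\<in>J. if \<Gamma> c y = x \<and> pos c = q then 1 else 0)"
      by (auto simp: coeff_sum intro!: sum.cong)
    ultimately show ?thesis
      using finJ by (simp add: sum.If_cases Int_def)
  qed
  have r: "0 < ?r"
  proof -
    obtain x where "x \<in> topspace ?X"
      using homog_sumD(1)[OF B l] by blast
    then obtain s where "s < ?r"
      using proj_diagonal_nonzero[OF B l] by blast
    then show ?thesis
      by simp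
  qed
  have inj: "m1 = m2" if "m1 < M" "m2 < M" "off m1 = off m2" for m1 m2
    using disjoint_blocks_unique[OF off(1) that(1,2), of "off m1"] that(3) r by auto
  have ex: "\<exists>c\<in>J. \<Gamma> c y = \<Lambda> m y \<and> pos c = off m" if y: "y \<in> topspace ?Y" for y
  proof -
    have "m \<in> {m' \<in> {..<M}. \<Lambda> m' y = \<Lambda> m y \<and> off m' = off m}"
      using m by simp
    then have "0 < card {m' \<in> {..<M}. \<Lambda> m' y = \<Lambda> m y \<and> off m' = off m}"
      by (subst card_gt_0_iff) auto
    then have "0 < card {c \<in> J. \<Gamma> c y = \<Lambda> m y \<and> pos c = off m}"
      by (simp only: count[OF \<Lambda>[OF m y] y])
    then show ?thesis
      by (auto simp only: card_gt_0_iff)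
  qed
  \<comment> \<open>The index \<open>c\<close> does not depend on \<open>y\<close>: two of them would give two blocks where \<open>off\<close> allows one.\<close>
  have uniq: "c1 = c2" if c: "c1 \<in> J" "c2 \<in> J" "pos c1 = off m" "pos c2 = off m" for c1 c2
  proof (rule ccontr)
    assume neq: "c1 \<noteq> c2"
    obtain y where y: "y \<in> topspace ?Y"
      using homog_sumD(1)[OF E k] by blast
    have eq: "\<Gamma> c y = \<Lambda> m y" if "c \<in> J" "pos c = off m" for c
    proof -
      define S where "S = {c' \<in> J. \<Gamma> c' y = \<Gamma> c y \<and> pos c' = off m}"
      have "c \<in> S" "finite S"
        using that finJ by (simp_all add: S_def)
      then have "0 < card S"
        by (auto simp only: card_gt_0_iff)
      then have "0 < card {m' \<in> {..<M}. \<Lambda> m' y = \<Gamma> c y \<and> off m' = off m}"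
        by (simp only: S_def count[OF \<Gamma>[OF that(1) y] y])
      then obtain m' where "m' < M" "\<Lambda> m' y = \<Gamma> c y" "off m' = off m"
        by (auto simp only: card_gt_0_iff)
      then show ?thesis
        using inj[OF _ m, of m'] by simp
    qed
    have "card {c1, c2} \<le> card {c \<in> J. \<Gamma> c y = \<Lambda> m y \<and> pos c = off m}"
      using finJ c eq by (intro card_mono) auto
    also have "\<dots> = card {m' \<in> {..<M}. \<Lambda> m' y = \<Lambda> m y \<and> off m' = off m}"
      using count[OF \<Lambda>[OF m y] y] by simp
    also have "\<dots> \<le> card {m}"
      using inj[OF _ m] by (intro card_mono) auto
    finally show False
      using neq by simp
  qed
  obtain c where c: "c \<in> J" "pos c = off m"
    using ex homog_sumD(1)[OF E k] by blast
  have "\<forall>y\<in>topspace ?Y. \<Lambda> m y = \<Gamma> c y"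
    using ex uniq[OF _ c(1) _ c(2)] by metis
  then show ?thesis
    using c(1) by (auto simp: J_def \<Gamma>_def)
qed


section \<open>Transport of covers along the inductive system\<close>

lemma fin_open_cover_join:
  assumes I: "finite I" and C: "\<And>i. i \<in> I \<Longrightarrow> fin_open_cover Y (C i)"
  shows "fin_open_cover Y (join_covers (topspace Y) I C)"
  unfolding fin_open_cover_def
proof (intro conjI ballI)
  have "join_covers (topspace Y) I C \<subseteq> (\<lambda>V. topspace Y \<inter> (\<Inter>i\<in>I. V i)) ` (\<Pi>\<^sub>E i\<in>I. C i)"
  proof
    fix W assume "W \<in> join_covers (topspace Y) I C"
    then obtain V where V: "W = topspace Y \<inter> (\<Inter>i\<in>I. V i)" "\<forall>i\<in>I. V i \<in> C i"
      by (auto simp: join_covers_def)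
    then have "W = topspace Y \<inter> (\<Inter>i\<in>I. restrict V I i)" "restrict V I \<in> (\<Pi>\<^sub>E i\<in>I. C i)"
      by auto
    then show "W \<in> (\<lambda>V. topspace Y \<inter> (\<Inter>i\<in>I. V i)) ` (\<Pi>\<^sub>E i\<in>I. C i)"
      by (rule image_eqI)
  qed
  moreover have "finite (\<Pi>\<^sub>E i\<in>I. C i)"
    using I C by (intro finite_PiE) (auto simp: fin_open_cover_def)
  ultimately show "finite (join_covers (topspace Y) I C)"
    by (meson finite_imageI finite_subset)
next
  fix W assume "W \<in> join_covers (topspace Y) I C"
  then obtain V where V: "W = topspace Y \<inter> \<Inter>(V ` I)" "\<forall>i\<in>I. V i \<in> C i"
    by (auto simp: join_covers_def)
  then show "openin Y W"
    using I C by (auto simp: fin_open_cover_def intro!: openin_Int_Inter)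
next
  show "\<Union>(join_covers (topspace Y) I C) = topspace Y"
  proof
    show "topspace Y \<subseteq> \<Union>(join_covers (topspace Y) I C)"
    proof
      fix y assume y: "y \<in> topspace Y"
      then have "\<forall>i\<in>I. \<exists>U\<in>C i. y \<in> U"
        using C by (fastforce simp: fin_open_cover_def)
      then obtain V where V: "\<forall>i\<in>I. V i \<in> C i \<and> y \<in> V i"
        by metis
      then have "topspace Y \<inter> (\<Inter>i\<in>I. V i) \<in> join_covers (topspace Y) I C"
        unfolding join_covers_def by blast
      then show "y \<in> \<Union>(join_covers (topspace Y) I C)"
        using V y by blast
    qed
  qed (auto simp: join_covers_def)
qed

lemma join_covers_refines:
  assumes "i \<in> I"
  shows "refines (join_covers Y I C) (C i)"
  unfolding refines_def
proof
  fix W assume "W \<in> join_covers Y I C"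
  then obtain V where "W = Y \<inter> (\<Inter>i\<in>I. V i)" "\<forall>i\<in>I. V i \<in> C i"
    by (auto simp: join_covers_def)
  then show "\<exists>U\<in>C i. W \<subseteq> U"
    using assms by (intro bexI[of _ "V i"]) auto
qed

lemma refines_join_covers:
  assumes "fin_open_cover Y \<gamma>" "\<And>i. i \<in> I \<Longrightarrow> refines \<gamma> (C i)"
  shows "refines \<gamma> (join_covers (topspace Y) I C)"
  unfolding refines_def
proof
  fix W assume W: "W \<in> \<gamma>"
  then have "\<forall>i\<in>I. \<exists>U. U \<in> C i \<and> W \<subseteq> U"
    using assms(2) unfolding refines_def by blast
  then obtain V where V: "\<forall>i\<in>I. V i \<in> C i \<and> W \<subseteq> V i"
    by metis
  have "W \<subseteq> topspace Y"
    using assms(1) W by (auto simp: fin_open_cover_def)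
  then have "W \<subseteq> topspace Y \<inter> (\<Inter>i\<in>I. V i)"
    using V by blast
  moreover have "topspace Y \<inter> (\<Inter>i\<in>I. V i) \<in> join_covers (topspace Y) I C"
    using V unfolding join_covers_def by blast
  ultimately show "\<exists>U\<in>join_covers (topspace Y) I C. W \<subseteq> U"
    by blast
qed

lemma refines_pullback: "refines \<beta> \<alpha> \<Longrightarrow> refines (pullback_cover Y f \<beta>) (pullback_cover Y f \<alpha>)"
  unfolding refines_def
proof
  fix V assume \<beta>: "\<forall>V\<in>\<beta>. \<exists>U\<in>\<alpha>. V \<subseteq> U" and "V \<in> pullback_cover Y f \<beta>"
  then obtain W where W: "W \<in> \<beta>" "V = {y \<in> topspace Y. f y \<in> W}"
    by (auto simp: pullback_cover_def)
  then obtain U where "U \<in> \<alpha>" "W \<subseteq> U"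
    using \<beta> by metis
  then show "\<exists>U\<in>pullback_cover Y f \<alpha>. V \<subseteq> U"
    using W(2) by (intro bexI[of _ "{y \<in> topspace Y. f y \<in> U}"]) (auto simp: pullback_cover_def)
qed

lemma pullback_pullback_refines:
  assumes "\<And>y. y \<in> topspace Y \<Longrightarrow> h y = f (g y)"
  shows "refines (pullback_cover Y g (pullback_cover Z f \<alpha>)) (pullback_cover Y h \<alpha>)"
  unfolding refines_def
proof
  fix V assume "V \<in> pullback_cover Y g (pullback_cover Z f \<alpha>)"
  then obtain U where "U \<in> \<alpha>" "V = {y \<in> topspace Y. g y \<in> {z \<in> topspace Z. f z \<in> U}}"
    by (auto simp: pullback_cover_def)
  then show "\<exists>W\<in>pullback_cover Y h \<alpha>. V \<subseteq> W"
    using assms by (intro bexI[of _ "{y \<in> topspace Y. h y \<in> U}"]) (auto simp: pullback_cover_def)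
qed

lemma fin_open_cover_induced:
  assumes \<alpha>: "\<alpha> \<in> component_covers B" and l: "l < num B"
  shows "fin_open_cover (base B l) (induced_cover B \<alpha> l)"
proof -
  have cover: "finite \<alpha>" "\<Union>\<alpha> = Sigma {..<num B} (topspace \<circ> base B)"
    and op: "\<And>U. U \<in> \<alpha> \<Longrightarrow> openin (sum_topology (base B) {..<num B}) U"
    and comp: "\<And>U. U \<in> \<alpha> \<Longrightarrow> \<exists>l<num B. U \<subseteq> {l} \<times> topspace (base B l)"
    using \<alpha> by (auto simp: component_covers_def fin_open_cover_def base_space_def)
  have "openin (base B l) (Pair l -` U)" if "U \<in> \<alpha>" for U
    using op[OF that] l by (simp add: openin_sum_topology vimage_def)
  moreover have "x \<in> \<Union>(induced_cover B \<alpha> l)" if x: "x \<in> topspace (base B l)" for x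
  proof -
    have "(l, x) \<in> \<Union>\<alpha>"
      using x l by (simp add: cover(2))
    then obtain U where U: "U \<in> \<alpha>" "(l, x) \<in> U"
      by blast
    then have "U \<subseteq> {l} \<times> topspace (base B l)"
      using comp[OF U(1)] by blast
    then show ?thesis
      using U by (auto simp: induced_cover_def)
  qed
  ultimately show ?thesis
    using cover(1) by (auto simp: fin_open_cover_def induced_cover_def)
qed

lemma AH_diagonalD:
  assumes "AH_diagonal A \<phi> \<mu> \<Lambda>"
  shows "homog_sum (A i)"
    and "i \<le> j \<Longrightarrow> unital_star_hom (A i) (A j) (conn \<phi> i j)"
    and "i < j \<Longrightarrow> l < num (A i) \<Longrightarrow> k < num (A j) \<Longrightarrow>
      diagonal_component (A i) (A j) (conn \<phi> i j) l k (\<mu> i j l k) (\<Lambda> i j l k)"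
    and "i < j \<Longrightarrow> l < num (A i) \<Longrightarrow> k < num (A j) \<Longrightarrow> m < \<mu> i j l k \<Longrightarrow>
      continuous_map (base (A j) k) (base (A i) l) (\<Lambda> i j l k m)"
  using assms unital_star_hom_conn[of A \<phi> i j]
  by (auto simp: AH_diagonal_def diagonal_component_def)

lemma fin_open_cover_transported:
  assumes "AH_diagonal A \<phi> \<mu> \<Lambda>" "i < j" "k < num (A j)" "\<alpha> \<in> component_covers (A i)"
  shows "fin_open_cover (base (A j) k) (transported_cover A \<mu> \<Lambda> i j k \<alpha>)"
  unfolding transported_cover_def
  using assms by (intro fin_open_cover_join)
    (auto intro!: fin_open_cover_pullback[OF fin_open_cover_induced] AH_diagonalD(4))

text \<open>Choose covers of the base spaces at stage \<open>j\<close> that realise the dimensions, and refine all their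
  preimages under the maps \<open>\<lambda>\<^bsub>j,j'\<^esub>\<close> at once. As the maps \<open>\<lambda>\<^bsub>i,j'\<^esub>\<close> factor through these, the result
  refines the transported cover; its order is bounded by subadditivity.\<close>

lemma cover_dim_transported_le:
  assumes AH: "AH_diagonal A \<phi> \<mu> \<Lambda>" and ij: "i < j" "j < j'" and k: "k < num (A j')"
    and \<alpha>: "\<alpha> \<in> component_covers (A i)"
  shows "cover_dim (base (A j') k) (transported_cover A \<mu> \<Lambda> i j' k \<alpha>) \<le>
    (\<Sum>h<num (A j). \<mu> j j' h k * cover_dim (base (A j) h) (transported_cover A \<mu> \<Lambda> i j h \<alpha>))"
proof -
  let ?Y = "base (A j') k" and ?T = "\<lambda>h. transported_cover A \<mu> \<Lambda> i j h \<alpha>"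
  have "\<exists>\<beta>. fin_open_cover (base (A j) h) \<beta> \<and> refines \<beta> (?T h) \<and>
      cover_ord (base (A j) h) \<beta> = cover_dim (base (A j) h) (?T h)" if "h < num (A j)" for h
    using cover_dim_attained[OF fin_open_cover_transported[OF AH ij(1) that \<alpha>]] by metis
  then obtain \<beta> where \<beta>: "\<And>h. h < num (A j) \<Longrightarrow> fin_open_cover (base (A j) h) (\<beta> h)"
      "\<And>h. h < num (A j) \<Longrightarrow> refines (\<beta> h) (?T h)"
      "\<And>h. h < num (A j) \<Longrightarrow> cover_ord (base (A j) h) (\<beta> h) = cover_dim (base (A j) h) (?T h)"
    by metis
  define I where "I = (SIGMA h:{..<num (A j)}. {..<\<mu> j j' h k})"
  define C where "C = (\<lambda>(h, b). pullback_cover ?Y (\<Lambda> j j' h k b) (\<beta> h))"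
  note Y = homog_sumD(1-3)[OF AH_diagonalD(1)[OF AH] k]
  have cont: "continuous_map ?Y (base (A j) h) (\<Lambda> j j' h k b)" if "(h, b) \<in> I" for h b
    using that AH_diagonalD(4)[OF AH ij(2) _ k] by (auto simp: I_def)
  have C: "fin_open_cover ?Y (C c)" if "c \<in> I" for c
    using that \<beta>(1) cont by (auto simp: I_def C_def intro!: fin_open_cover_pullback)
  obtain \<gamma> where \<gamma>: "fin_open_cover ?Y \<gamma>" "\<forall>c\<in>I. refines \<gamma> (C c)"
      "cover_ord ?Y \<gamma> \<le> (\<Sum>c\<in>I. cover_ord ?Y (C c))"
    using common_refinement_family[OF Y(2,3,1), of I C] C by (auto simp: I_def)
  have "refines \<gamma> (transported_cover A \<mu> \<Lambda> i j' k \<alpha>)"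
    unfolding transported_cover_def
  proof (rule refines_join_covers[OF \<gamma>(1)], clarsimp)
    fix l m assume l: "l < num (A i)" and m: "m < \<mu> i j' l k"
    have "\<exists>h<num (A j). \<exists>b<\<mu> j j' h k. \<exists>a<\<mu> i j l h.
        \<forall>y\<in>topspace ?Y. \<Lambda> i j' l k m y = \<Lambda> i j l h a (\<Lambda> j j' h k b y)"
    proof (rule diagonal_maps_compose[where B = "A i" and C = "A j" and E = "A j'"])
      show "diagonal_component (A i) (A j') (conn \<phi> j j' \<circ> conn \<phi> i j) l k (\<mu> i j' l k) (\<Lambda> i j' l k)"
        using AH_diagonalD(3)[OF AH _ l k] ij conn_comp[of i j j' \<phi>] by simp
    qed (use AH_diagonalD[OF AH] ij l k m in auto)
    then obtain h b a where h: "h < num (A j)" "b < \<mu> j j' h k" "a < \<mu> i j l h"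
        "\<And>y. y \<in> topspace ?Y \<Longrightarrow> \<Lambda> i j' l k m y = \<Lambda> i j l h a (\<Lambda> j j' h k b y)"
      by blast
    then have hb: "(h, b) \<in> I"
      by (simp add: I_def)
    let ?P = "\<lambda>h a. pullback_cover (base (A j) h) (\<Lambda> i j l h a) (induced_cover (A i) \<alpha> l)"
    have "refines (?T h) (?P h a)"
      unfolding transported_cover_def
      using join_covers_refines[of "(l, a)" "SIGMA l:{..<num (A i)}. {..<\<mu> i j l h}" _
          "\<lambda>(l, m). pullback_cover (base (A j) h) (\<Lambda> i j l h m) (induced_cover (A i) \<alpha> l)"]
        l h(3) by auto
    then have "refines (\<beta> h) (?P h a)"
      using \<beta>(2)[OF h(1)] refines_trans by blast
    then have "refines (C (h, b)) (pullback_cover ?Y (\<Lambda> j j' h k b) (?P h a))"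
      by (simp add: C_def refines_pullback)
    then have "refines \<gamma> (pullback_cover ?Y (\<Lambda> j j' h k b) (?P h a))"
      using \<gamma>(2) hb refines_trans by blast
    moreover have "refines (pullback_cover ?Y (\<Lambda> j j' h k b) (?P h a))
        (pullback_cover ?Y (\<Lambda> i j' l k m) (induced_cover (A i) \<alpha> l))"
      using h(4) by (intro pullback_pullback_refines) auto
    ultimately show "refines \<gamma> (pullback_cover ?Y (\<Lambda> i j' l k m) (induced_cover (A i) \<alpha> l))"
      by (rule refines_trans)
  qed
  then have "cover_dim ?Y (transported_cover A \<mu> \<Lambda> i j' k \<alpha>) \<le> cover_ord ?Y \<gamma>"
    by (rule cover_dim_le[OF \<gamma>(1)])
  also have "\<dots> \<le> (\<Sum>(h, b)\<in>I. cover_dim (base (A j) h) (?T h))"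
  proof (rule order_trans[OF \<gamma>(3)], rule sum_mono, clarify)
    fix h b assume hb: "(h, b) \<in> I"
    then have "h < num (A j)"
      by (simp add: I_def)
    then show "cover_ord ?Y (C (h, b)) \<le> cover_dim (base (A j) h) (?T h)"
      using cover_ord_pullback_le[OF \<beta>(1) cont[OF hb] Y(1)] \<beta>(3) by (simp add: C_def)
  qed
  also have "\<dots> = (\<Sum>h<num (A j). \<mu> j j' h k * cover_dim (base (A j) h) (?T h))"
    unfolding I_def by (subst sum.Sigma[symmetric]) auto
  finally show ?thesis .
qed

lemma Max_image_mono:
  fixes f g :: "'b \<Rightarrow> 'c :: linorder"
  assumes "finite S" "S \<noteq> {}" "\<And>k. k \<in> S \<Longrightarrow> f k \<le> g k"
  shows "(MAX k\<in>S. f k) \<le> (MAX k\<in>S. g k)"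
  using assms by (auto simp: Max_le_iff intro!: order_trans[OF assms(3) Max_ge])

definition dim_ratio ::
    "(nat \<Rightarrow> 'a homog_sum) \<Rightarrow> (nat \<Rightarrow> nat \<Rightarrow> nat \<Rightarrow> nat \<Rightarrow> nat) \<Rightarrow>
     (nat \<Rightarrow> nat \<Rightarrow> nat \<Rightarrow> nat \<Rightarrow> nat \<Rightarrow> 'a \<Rightarrow> 'a) \<Rightarrow> nat \<Rightarrow> (nat \<times> 'a) set set \<Rightarrow> nat \<Rightarrow> real" where
  "dim_ratio A \<mu> \<Lambda> i \<alpha> j = (MAX k\<in>{..<num (A j)}.
     real (cover_dim (base (A j) k) (transported_cover A \<mu> \<Lambda> i j k \<alpha>)) / real (prank (A j) k))"

lemma dim_ratio_decreasing:
  assumes AH: "AH_diagonal A \<phi> \<mu> \<Lambda>" and ij: "i < j" "j < j'"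
    and \<alpha>: "\<alpha> \<in> component_covers (A i)"
  shows "dim_ratio A \<mu> \<Lambda> i \<alpha> j' \<le> dim_ratio A \<mu> \<Lambda> i \<alpha> j"
proof -
  let ?D = "\<lambda>j k. real (cover_dim (base (A j) k) (transported_cover A \<mu> \<Lambda> i j k \<alpha>))"
  have A: "homog_sum (A n)" for n
    using AH_diagonalD(1)[OF AH] .
  have D: "?D j h \<le> dim_ratio A \<mu> \<Lambda> i \<alpha> j * prank (A j) h" if h: "h < num (A j)" for h
  proof -
    have "?D j h / real (prank (A j) h) \<le> dim_ratio A \<mu> \<Lambda> i \<alpha> j"
      unfolding dim_ratio_def using h by (intro Max_ge) auto
    then show ?thesis
      using homog_sumD(4)[OF A h] by (simp add: divide_le_eq)
  qed
  have "?D j' k / real (prank (A j') k) \<le> dim_ratio A \<mu> \<Lambda> i \<alpha> j" if k: "k < num (A j')" for k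
  proof -
    have "?D j' k \<le> (\<Sum>h<num (A j). real (\<mu> j j' h k) * ?D j h)"
      using cover_dim_transported_le[OF AH ij k \<alpha>] by (simp flip: of_nat_mult of_nat_sum)
    also have "\<dots> \<le> (\<Sum>h<num (A j). real (\<mu> j j' h k) * (dim_ratio A \<mu> \<Lambda> i \<alpha> j * prank (A j) h))"
      using D by (intro sum_mono mult_left_mono) auto
    also have "\<dots> = dim_ratio A \<mu> \<Lambda> i \<alpha> j * real (\<Sum>h<num (A j). \<mu> j j' h k * prank (A j) h)"
      by (simp add: sum_distrib_left mult_ac)
    also have "(\<Sum>h<num (A j). \<mu> j j' h k * prank (A j) h) = prank (A j') k"
      by (rule diagonal_hom_rank[OF A A AH_diagonalD(2)[OF AH less_imp_le[OF ij(2)]] k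
            AH_diagonalD(3)[OF AH ij(2) _ k]])
    finally show ?thesis
      using homog_sumD(4)[OF A k] by (simp add: divide_le_eq)
  qed
  moreover have "{..<num (A j')} \<noteq> {}"
    using A[of j'] by (auto simp: homog_sum_def)
  ultimately show ?thesis
    unfolding dim_ratio_def[of A \<mu> \<Lambda> i \<alpha> j'] by (subst Max_le_iff) auto
qed

text \<open>Below stage \<open>i\<close> and at \<open>i\<close> itself the terms are meaningless, hence the shift by \<open>Suc i\<close>.\<close>

lemma dim_ratio_tendsto_lim:
  assumes AH: "AH_diagonal A \<phi> \<mu> \<Lambda>" and \<alpha>: "\<alpha> \<in> component_covers (A i)"
  shows "(\<lambda>j. ereal (dim_ratio A \<mu> \<Lambda> i \<alpha> j)) \<longlonglongrightarrow> lim (\<lambda>j. ereal (dim_ratio A \<mu> \<Lambda> i \<alpha> j))"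
proof -
  let ?a = "\<lambda>j. ereal (dim_ratio A \<mu> \<Lambda> i \<alpha> j)"
  have "decseq (\<lambda>j. ?a (j + Suc i))"
    using dim_ratio_decreasing[OF AH _ _ \<alpha>] by (intro decseq_SucI) simp
  then have "(\<lambda>j. ?a (j + Suc i)) \<longlonglongrightarrow> (INF j. ?a (j + Suc i))"
    by (rule LIMSEQ_INF)
  then have "?a \<longlonglongrightarrow> (INF j. ?a (j + Suc i))"
    by (rule LIMSEQ_offset)
  then show ?thesis
    using limI by metis
qed


section \<open>Comparison with variation covers\<close>

lemma variation_dim_le:
  "\<beta> \<in> variation_covers X F \<epsilon> \<Longrightarrow> variation_dim X F \<epsilon> \<le> cover_ord X \<beta>"
  unfolding variation_dim_def by (intro cInf_lower) auto

lemma variation_dim_attained: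
  assumes "variation_covers X F \<epsilon> \<noteq> {}"
  obtains \<beta> where "\<beta> \<in> variation_covers X F \<epsilon>" "cover_ord X \<beta> = variation_dim X F \<epsilon>"
proof -
  have "Inf (cover_ord X ` variation_covers X F \<epsilon>) \<in> cover_ord X ` variation_covers X F \<epsilon>"
    using assms by (intro Inf_nat_def1) auto
  then show ?thesis
    using that by (auto simp: variation_dim_def)
qed

lemma l2_bounded_mono: "l2_bounded B c \<Longrightarrow> c \<le> d \<Longrightarrow> l2_bounded B d"
  unfolding l2_bounded_def by (meson mult_right_mono order_trans vec_l2norm_nonneg)

lemma small_variation_cover:
  assumes X: "compact_space X" and F: "finite F" "\<And>f. f \<in> F \<Longrightarrow> mat_continuous X r f" and "0 < \<delta>"
  obtains \<beta> where "fin_open_cover X \<beta>"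
    "\<And>U x y f. U \<in> \<beta> \<Longrightarrow> x \<in> U \<Longrightarrow> y \<in> U \<Longrightarrow> f \<in> F \<Longrightarrow> l2_bounded (f x - f y) \<delta>"
proof -
  \<comment> \<open>The operator norm is at most the sum of the \<open>r\<^sup>2\<close> entries, and within a member of the cover an
    entry varies by less than \<open>2 \<eta>\<close>. The summand 1 covers the case \<open>r = 0\<close>.\<close>
  define \<eta> where "\<eta> = \<delta> / (2 * real (r * r) + 1)"
  have \<eta>: "0 < \<eta>" "real (r * r) * (2 * \<eta>) \<le> \<delta>"
  proof -
    have pos: "0 < 2 * real (r * r) + 1"
      by (intro add_nonneg_pos) auto
    then show "0 < \<eta>"
      using \<open>0 < \<delta>\<close> unfolding \<eta>_def by (rule divide_pos_pos[rotated])
    then have "real (r * r) * (2 * \<eta>) \<le> (2 * real (r * r) + 1) * \<eta>"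
      by (simp add: algebra_simps)
    also have "\<dots> = \<delta>"
      using pos by (simp add: \<eta>_def)
    finally show "real (r * r) * (2 * \<eta>) \<le> \<delta>" .
  qed
  define S where "S x = (\<lambda>(f, s, t). {z \<in> topspace X. f z $$ (s, t) \<in> ball (f x $$ (s, t) :: complex) \<eta>})"
    for x
  define N where "N x = topspace X \<inter> \<Inter>(S x ` (F \<times> {..<r} \<times> {..<r}))" for x
  have "openin X (N x)" for x
    unfolding N_def
  proof (rule openin_Int_Inter)
    fix U assume "U \<in> S x ` (F \<times> {..<r} \<times> {..<r})"
    then show "openin X U"
      using F(2) by (auto simp: S_def mat_continuous_def simp del: mem_ball
          intro!: openin_continuous_map_preimage[where Y = euclidean])
  qed (use F in auto)
  moreover have "x \<in> N x" if "x \<in> topspace X" for x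
    using that \<eta> by (auto simp: N_def S_def)
  ultimately obtain \<beta> where \<beta>: "finite \<beta>" "\<beta> \<subseteq> N ` topspace X" "topspace X \<subseteq> \<Union>\<beta>"
    using X[unfolded compact_space_alt, rule_format, of "N ` topspace X"] by fastforce
  have "fin_open_cover X \<beta>"
    using \<beta> \<open>\<And>x. openin X (N x)\<close> by (auto simp: fin_open_cover_def N_def)
  moreover have "l2_bounded (f x - f y) \<delta>" if U: "U \<in> \<beta>" "x \<in> U" "y \<in> U" "f \<in> F" for U x y f
  proof -
    obtain c where c: "U = N c"
      using U(1) \<beta>(2) by auto
    have xy: "f x \<in> carrier_mat r r" "f y \<in> carrier_mat r r"
      using U c F(2) by (auto simp: N_def mat_continuous_def)
    have "cmod ((f x - f y) $$ (s, t)) \<le> 2 * \<eta>" if st: "s < r" "t < r" for s t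
    proof -
      have "dist (f c $$ (s, t)) (f x $$ (s, t)) < \<eta>" "dist (f c $$ (s, t)) (f y $$ (s, t)) < \<eta>"
        using U st c by (auto simp: N_def S_def)
      then have "dist (f x $$ (s, t)) (f y $$ (s, t)) \<le> 2 * \<eta>"
        using dist_triangle3[of "f x $$ (s, t)" "f y $$ (s, t)" "f c $$ (s, t)"] by simp
      then show ?thesis
        using xy st by (simp add: dist_norm)
    qed
    then have "(\<Sum>s<r. \<Sum>t<r. cmod ((f x - f y) $$ (s, t))) \<le> (\<Sum>s<r. \<Sum>t<r. 2 * \<eta>)"
      by (intro sum_mono) auto
    also have "\<dots> \<le> \<delta>"
      using \<eta>(2) by (simp add: mult_ac)
    finally show ?thesis
      using l2_bounded_entry_sum[of "f x - f y"] xy by (auto intro: l2_bounded_mono)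
  qed
  ultimately show ?thesis
    using that by blast
qed

text \<open>The empty set lies in every component, so if it is a member of some \<open>\<beta> l\<close>, it is induced on all
  components.\<close>

lemma component_cover_of_covers:
  assumes \<beta>: "\<And>l. l < num B \<Longrightarrow> fin_open_cover (base B l) (\<beta> l)"
  obtains \<alpha> where "\<alpha> \<in> component_covers B"
    "\<And>l. l < num B \<Longrightarrow> induced_cover B \<alpha> l \<subseteq> insert {} (\<beta> l)"
proof -
  define \<alpha> where "\<alpha> = (\<Union>l<num B. (\<lambda>V. {l} \<times> V) ` \<beta> l)"
  have sub: "V \<subseteq> topspace (base B l)" if "l < num B" "V \<in> \<beta> l" for l V
    using \<beta>[OF that(1)] that(2) by (auto simp: fin_open_cover_def)
  have "openin (sum_topology (base B) {..<num B}) ({l} \<times> V)" if l: "l < num B" and V: "V \<in> \<beta> l" for l V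
  proof -
    have "openin (base B l') {x. (l', x) \<in> {l} \<times> V}" if "l' < num B" for l'
      using \<beta>[OF l] V by (cases "l' = l") (auto simp: fin_open_cover_def)
    then show ?thesis
      using sub[OF l V] l by (auto simp: openin_sum_topology)
  qed
  moreover have "\<Union>\<alpha> = Sigma {..<num B} (topspace \<circ> base B)"
    using \<beta> by (fastforce simp: \<alpha>_def fin_open_cover_def)
  moreover have "finite \<alpha>"
    using \<beta> by (auto simp: \<alpha>_def fin_open_cover_def)
  ultimately have "\<alpha> \<in> component_covers B"
    using sub by (fastforce simp: component_covers_def fin_open_cover_def base_space_def \<alpha>_def)
  moreover have "induced_cover B \<alpha> l \<subseteq> insert {} (\<beta> l)" if "l < num B" for l
  proof
    fix W assume "W \<in> induced_cover B \<alpha> l"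
    then obtain l' V where W: "W = Pair l -` ({l'} \<times> V)" "V \<in> \<beta> l'"
      by (auto simp: induced_cover_def \<alpha>_def)
    then show "W \<in> insert {} (\<beta> l)"
      by (cases "l' = l") auto
  qed
  ultimately show ?thesis
    using that by blast
qed

text \<open>The bound depends on the number of summands at stage \<open>i\<close> only, not on \<open>j\<close> or on the number of
  blocks.\<close>

lemma conn_diff_l2_bounded:
  assumes AH: "AH_diagonal A \<phi> \<mu> \<Lambda>" and ij: "i < j" and k: "k < num (A j)" and f: "f \<in> alg (A i)"
    and y: "y \<in> topspace (base (A j) k)" and z: "z \<in> topspace (base (A j) k)" and "0 \<le> \<delta>"
    and \<delta>: "\<And>l m. l < num (A i) \<Longrightarrow> m < \<mu> i j l k \<Longrightarrow>
      l2_bounded (f l (\<Lambda> i j l k m y) - f l (\<Lambda> i j l k m z)) \<delta>"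
  shows "l2_bounded (conn \<phi> i j f k y - conn \<phi> i j f k z) (real (num (A i)) * \<delta>)"
proof -
  let ?\<psi> = "conn \<phi> i j" and ?R = "msize (A j) k"
  let ?D = "\<lambda>l. ?\<psi> (summand_incl (A i) l (f l)) k y - ?\<psi> (summand_incl (A i) l (f l)) k z"
  have A: "homog_sum (A n)" for n
    using AH_diagonalD(1)[OF AH] .
  have \<psi>: "unital_star_hom (A i) (A j) ?\<psi>"
    using AH_diagonalD(2)[OF AH] ij by simp
  have carrier: "?\<psi> g k x \<in> carrier_mat ?R ?R"
    if "g \<in> alg (A i)" "x \<in> topspace (base (A j) k)" for g x
    using \<psi> that alg_carrier[OF _ k] by (auto simp: unital_star_hom_def)
  have fl: "f l \<in> summand (A i) l" if "l < num (A i)" for l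
    using f that by (auto simp: alg_def)
  have incl: "summand_incl (A i) l (f l) \<in> alg (A i)" if "l < num (A i)" for l
    using summand_incl_in_alg[OF A that fl[OF that]] .
  have bounded: "l2_bounded (?D l) \<delta>" if l: "l < num (A i)" for l
  proof -
    obtain off where off: "disjoint_blocks ?R (msize (A i) l) (\<mu> i j l k) off"
      "\<And>x. x \<in> topspace (base (A j) k) \<Longrightarrow> ?\<psi> (summand_incl (A i) l (f l)) k x =
         block_diag ?R (msize (A i) l) (\<mu> i j l k) off (\<lambda>m. f l (\<Lambda> i j l k m x))"
      using AH_diagonalD(3)[OF AH ij l k] fl[OF l] unfolding diagonal_component_def by blast
    have c: "f l (\<Lambda> i j l k m x) \<in> carrier_mat (msize (A i) l) (msize (A i) l)"
      if "m < \<mu> i j l k" "x \<in> topspace (base (A j) k)" for m x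
      using AH_diagonalD(4)[OF AH ij l k that(1)] that(2) summand_carrier[OF fl[OF l]]
      by (auto simp: continuous_map_def)
    have "?D l = block_diag ?R (msize (A i) l) (\<mu> i j l k) off
        (\<lambda>m. f l (\<Lambda> i j l k m y) - f l (\<Lambda> i j l k m z))"
      using c y z by (simp add: off(2) block_diag_diff)
    moreover have "l2_bounded \<dots> \<delta>"
      using c y z \<delta>[OF l] \<open>0 \<le> \<delta>\<close>
      by (intro l2_bounded_block_diag[OF off(1)] conjI minus_carrier_mat) auto
    ultimately show ?thesis
      by simp
  qed
  have "l2_bounded (?\<psi> f k y - ?\<psi> f k z) (real (card {..<num (A i)}) * \<delta>)"
  proof (rule l2_bounded_sum)
    show "?D l \<in> carrier_mat ?R ?R \<and> l2_bounded (?D l) \<delta>" if "l \<in> {..<num (A i)}" for l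
      using bounded carrier[OF incl] that y z by (auto intro!: minus_carrier_mat)
    show "?\<psi> f k y - ?\<psi> f k z \<in> carrier_mat ?R ?R"
      using carrier[OF f] z by (auto intro!: minus_carrier_mat)
    fix s t assume st: "s < ?R" "t < ?R"
    have "(?\<psi> f k y - ?\<psi> f k z) $$ (s, t) = ?\<psi> f k y $$ (s, t) - ?\<psi> f k z $$ (s, t)"
      using carrier[OF f z] st by (intro index_minus_mat(1)) auto
    also have "\<dots> = (\<Sum>l<num (A i). ?\<psi> (summand_incl (A i) l (f l)) k y $$ (s, t) -
        ?\<psi> (summand_incl (A i) l (f l)) k z $$ (s, t))"
      using hom_entry_eq_sum[OF A \<psi> f k _ st] y z by (simp add: sum_subtractf)
    also have "\<dots> = (\<Sum>l<num (A i). ?D l $$ (s, t))"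
      using st by (intro sum.cong refl index_minus_mat(1)[symmetric])
        (auto simp: carrier_matD[OF carrier[OF incl z]])
    finally show "(?\<psi> f k y - ?\<psi> f k z) $$ (s, t) = (\<Sum>l<num (A i). ?D l $$ (s, t))" .
  qed simp
  then show ?thesis
    by simp
qed

text \<open>The half of the comparison that gives \<open>\<nu>\<^sub>i \<le> \<gamma>\<^sub>i\<close>. The cover \<open>\<alpha>\<close> works for all later stages simultaneously.
  As transported covers exist, it also shows that variation covers exist, so that the minimum in
  the definition of \<open>variation_dim\<close> is attained.\<close>

lemma transported_refinements_in_variation_covers:
  assumes AH: "AH_diagonal A \<phi> \<mu> \<Lambda>" and F: "finite F" "F \<subseteq> alg (A i)" and "0 < \<epsilon>"
  obtains \<alpha> where "\<alpha> \<in> component_covers (A i)"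
    "\<And>j k \<beta>. i < j \<Longrightarrow> k < num (A j) \<Longrightarrow> fin_open_cover (base (A j) k) \<beta> \<Longrightarrow>
      refines \<beta> (transported_cover A \<mu> \<Lambda> i j k \<alpha>) \<Longrightarrow>
      \<beta> \<in> variation_covers (base (A j) k) ((\<lambda>f. conn \<phi> i j f k) ` F) \<epsilon>"
proof -
  have A: "homog_sum (A n)" for n
    using AH_diagonalD(1)[OF AH] .
  \<comment> \<open>The contributions of all \<open>num (A i)\<close> summands have to add up to strictly less than \<open>\<epsilon>\<close>.\<close>
  define \<delta> where "\<delta> = \<epsilon> / (real (num (A i)) + 1)"
  have \<delta>: "0 < \<delta>" "real (num (A i)) * \<delta> < \<epsilon>"
    using \<open>0 < \<epsilon>\<close> by (auto simp: \<delta>_def field_simps)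
  have "\<exists>\<beta>. fin_open_cover (base (A i) l) \<beta> \<and>
      (\<forall>U\<in>\<beta>. \<forall>x\<in>U. \<forall>y\<in>U. \<forall>f\<in>F. l2_bounded (f l x - f l y) \<delta>)" if l: "l < num (A i)" for l
  proof -
    have "mat_continuous (base (A i) l) (msize (A i) l) g" if "g \<in> (\<lambda>f. f l) ` F" for g
      using that F(2) l by (auto simp: alg_def summand_def)
    then obtain \<beta> where "fin_open_cover (base (A i) l) \<beta>"
      "\<And>U x y g. U \<in> \<beta> \<Longrightarrow> x \<in> U \<Longrightarrow> y \<in> U \<Longrightarrow> g \<in> (\<lambda>f. f l) ` F \<Longrightarrow> l2_bounded (g x - g y) \<delta>"
      using small_variation_cover[OF homog_sumD(2)[OF A l], of "(\<lambda>f. f l) ` F"] F(1) \<delta>(1)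
      by (metis finite_imageI)
    then show ?thesis
      by blast
  qed
  then obtain \<beta> where \<beta>: "\<And>l. l < num (A i) \<Longrightarrow> fin_open_cover (base (A i) l) (\<beta> l)"
    "\<And>l U x y f. l < num (A i) \<Longrightarrow> U \<in> \<beta> l \<Longrightarrow> x \<in> U \<Longrightarrow> y \<in> U \<Longrightarrow> f \<in> F \<Longrightarrow>
      l2_bounded (f l x - f l y) \<delta>"
    by metis
  obtain \<alpha> where \<alpha>: "\<alpha> \<in> component_covers (A i)"
    "\<And>l. l < num (A i) \<Longrightarrow> induced_cover (A i) \<alpha> l \<subseteq> insert {} (\<beta> l)"
    using component_cover_of_covers[of "A i" \<beta>] \<beta>(1) by metis
  have "\<gamma> \<in> variation_covers (base (A j) k) ((\<lambda>f. conn \<phi> i j f k) ` F) \<epsilon>"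
    if j: "i < j" and k: "k < num (A j)" and \<gamma>: "fin_open_cover (base (A j) k) \<gamma>"
      "refines \<gamma> (transported_cover A \<mu> \<Lambda> i j k \<alpha>)" for j k \<gamma>
  proof -
    have "mat_opnorm (conn \<phi> i j f k y - conn \<phi> i j f k z) < \<epsilon>"
      if V: "V \<in> \<gamma>" "y \<in> V" "z \<in> V" and f: "f \<in> F" for V y z f
    proof -
      have yz: "y \<in> topspace (base (A j) k)" "z \<in> topspace (base (A j) k)"
        using \<gamma>(1) V by (auto simp: fin_open_cover_def)
      have "l2_bounded (f l (\<Lambda> i j l k m y) - f l (\<Lambda> i j l k m z)) \<delta>"
        if lm: "l < num (A i)" "m < \<mu> i j l k" for l m
      proof -
        have "refines \<gamma> (pullback_cover (base (A j) k) (\<Lambda> i j l k m) (induced_cover (A i) \<alpha> l))"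
          using refines_trans[OF \<gamma>(2)[unfolded transported_cover_def] join_covers_refines[of "(l, m)"]] lm
          by auto
        then obtain W where "W \<in> pullback_cover (base (A j) k) (\<Lambda> i j l k m) (induced_cover (A i) \<alpha> l)"
            "V \<subseteq> W"
          using V(1) unfolding refines_def by metis
        then obtain U where U: "U \<in> induced_cover (A i) \<alpha> l" "\<Lambda> i j l k m y \<in> U" "\<Lambda> i j l k m z \<in> U"
          using V(2,3) by (auto simp: pullback_cover_def)
        then have "U \<in> \<beta> l"
          using \<alpha>(2)[OF lm(1)] by auto
        then show ?thesis
          using \<beta>(2) U lm(1) f by blast
      qed
      then have "l2_bounded (conn \<phi> i j f k y - conn \<phi> i j f k z) (real (num (A i)) * \<delta>)"
        using conn_diff_l2_bounded[OF AH j k _ yz] F(2) f \<delta>(1) by auto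
      then have "mat_opnorm (conn \<phi> i j f k y - conn \<phi> i j f k z) \<le> real (num (A i)) * \<delta>"
        using \<delta>(1) by (intro mat_opnorm_le) auto
      then show ?thesis
        using \<delta>(2) by simp
    qed
    then show ?thesis
      using \<gamma>(1) by (auto simp: variation_covers_def)
  qed
  then show ?thesis
    using that \<alpha>(1) by blast
qed

lemma mat_opnorm_nonneg: "0 \<le> mat_opnorm (B :: complex mat)" if "0 < dim_col B"
proof -
  let ?v = "unit_vec (dim_col B) 0 :: complex vec"
  have "vec_l2norm ?v > 0"
    using member_le_L2_set[of "{..<dim_col B}" 0 "\<lambda>s. cmod (?v $ s)"] that
    by (simp add: vec_l2norm_eq_L2_set)
  moreover have "0 \<le> mat_opnorm B * vec_l2norm ?v"
    using l2_bounded_mat_opnorm[of B] vec_l2norm_nonneg[of "B *\<^sub>v ?v"]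
    unfolding l2_bounded_def by (meson order_trans unit_vec_carrier)
  ultimately show ?thesis
    by (simp add: zero_le_mult_iff)
qed

text \<open>The half of the comparison that gives \<open>\<gamma>\<^sub>i \<le> \<nu>\<^sub>i\<close>. The elements of \<open>F\<close> are the projections cut down by bump
  functions of the covers induced by \<open>\<alpha>\<close>; the tolerance can be \<open>1\<close> because for every point some bump
  function is at least \<open>1\<close> there.\<close>

lemma variation_covers_refine_transported:
  assumes AH: "AH_diagonal A \<phi> \<mu> \<Lambda>" and \<alpha>: "\<alpha> \<in> component_covers (A i)"
  obtains F where "finite F" "F \<subseteq> alg (A i)"
    "\<And>j k \<beta>. i < j \<Longrightarrow> k < num (A j) \<Longrightarrow>
      \<beta> \<in> variation_covers (base (A j) k) ((\<lambda>f. conn \<phi> i j f k) ` F) 1 \<Longrightarrow>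
      refines \<beta> (transported_cover A \<mu> \<Lambda> i j k \<alpha>)"
proof -
  have A: "homog_sum (A n)" for n
    using AH_diagonalD(1)[OF AH] .
  let ?C = "induced_cover (A i) \<alpha>"
  have ind: "fin_open_cover (base (A i) l) (?C l)" if "l < num (A i)" for l
    using fin_open_cover_induced[OF \<alpha> that] .
  define Q where "Q l g \<longleftrightarrow> (\<forall>U. continuous_map (base (A i) l) euclideanreal (g U)) \<and>
      (\<forall>U. \<forall>x\<in>topspace (base (A i) l). x \<notin> U \<longrightarrow> g U x = 0) \<and>
      (\<forall>x\<in>topspace (base (A i) l). \<exists>U\<in>?C l. 1 \<le> g U x)"
    for l and g :: "'a set \<Rightarrow> 'a \<Rightarrow> real"
  have "\<exists>g. Q l g" if l: "l < num (A i)" for l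
    using bump_functions[OF homog_sumD(2,3)[OF A l] ind[OF l]] unfolding Q_def by metis
  then obtain g where Q: "\<And>l. l < num (A i) \<Longrightarrow> Q l (g l)"
    by metis
  define e where "e l U = summand_incl (A i) l (scaled_proj (A i) l (g l U))" for l U
  define F where "F = (\<Union>l<num (A i). e l ` ?C l)"
  have sp: "scaled_proj (A i) l (g l U) \<in> summand (A i) l" if "l < num (A i)" for l U
    using scaled_proj_in_summand[OF A that] Q[OF that] by (simp add: Q_def)
  have "finite F"
    using ind by (auto simp: F_def fin_open_cover_def)
  moreover have "F \<subseteq> alg (A i)"
    using summand_incl_in_alg[OF A _ sp] by (auto simp: F_def e_def)
  moreover have "refines \<beta> (transported_cover A \<mu> \<Lambda> i j k \<alpha>)"
    if j: "i < j" and k: "k < num (A j)"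
      and \<beta>: "\<beta> \<in> variation_covers (base (A j) k) ((\<lambda>f. conn \<phi> i j f k) ` F) 1" for j k \<beta>
    unfolding transported_cover_def
  proof (rule refines_join_covers, use \<beta> in \<open>simp add: variation_covers_def\<close>, clarsimp)
    fix l m assume l: "l < num (A i)" and m: "m < \<mu> i j l k"
    let ?Y = "base (A j) k" and ?X = "base (A i) l" and ?L = "\<Lambda> i j l k m"
    let ?r = "msize (A i) l" and ?R = "msize (A j) k"
    have L: "?L y \<in> topspace ?X" if "y \<in> topspace ?Y" for y
      using AH_diagonalD(4)[OF AH j l k m] that by (auto simp: continuous_map_def)
    \<comment> \<open>If \<open>?L z\<close> is outside \<open>U\<close>, then the block at \<open>z\<close> vanishes, and the difference of the blocks is
      the multiple \<open>g l U (?L y) \<ge> 1\<close> of a nonzero projection, which has norm at least 1.\<close>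
    have key: "?L z \<in> U" if U: "U \<in> ?C l" and V: "V \<in> \<beta>" "y \<in> V" "z \<in> V" and y: "1 \<le> g l U (?L y)"
      for U V y z
    proof (rule ccontr)
      assume notin: "?L z \<notin> U"
      have yz: "y \<in> topspace ?Y" "z \<in> topspace ?Y"
        using \<beta> V by (auto simp: variation_covers_def fin_open_cover_def)
      let ?s = "scaled_proj (A i) l (g l U)" and ?\<psi> = "conn \<phi> i j"
      let ?b = "\<lambda>m. ?s (\<Lambda> i j l k m y) - ?s (\<Lambda> i j l k m z)"
      let ?D = "?\<psi> (e l U) k y - ?\<psi> (e l U) k z"
      obtain off where off: "disjoint_blocks ?R ?r (\<mu> i j l k) off"
        "\<And>x. x \<in> topspace ?Y \<Longrightarrow> ?\<psi> (e l U) k x =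
           block_diag ?R ?r (\<mu> i j l k) off (\<lambda>m. ?s (\<Lambda> i j l k m x))"
        using AH_diagonalD(3)[OF AH j l k] sp[OF l] unfolding diagonal_component_def e_def by blast
      have c: "?s (\<Lambda> i j l k m' x) \<in> carrier_mat ?r ?r"
        if "m' < \<mu> i j l k" "x \<in> topspace ?Y" for m' x
        using AH_diagonalD(4)[OF AH j l k that(1)] that(2) summand_carrier[OF sp[OF l]]
        by (auto simp: continuous_map_def)
      have D: "?D = block_diag ?R ?r (\<mu> i j l k) off ?b"
        using c yz by (simp add: off(2) block_diag_diff)
      have small: "mat_opnorm ?D < 1"
        using \<beta> V U l by (force simp: variation_covers_def F_def)
      obtain w where w: "w \<in> carrier_vec ?r" "proj (A i) l (?L y) *\<^sub>v w = w" "0 < vec_l2norm w"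
        using proj_fixed_vector[OF A l L[OF yz(1)]] .
      obtain s where s: "s < ?r"
        using proj_diagonal_nonzero[OF A l L[OF yz(1)]] by blast
      have "off m + ?r \<le> ?R"
        using off(1) m by (auto simp: disjoint_blocks_def)
      then have "0 < dim_col ?D"
        using s by (simp only: D) (simp add: block_diag_def)
      then have nonneg: "0 \<le> mat_opnorm ?D"
        by (rule mat_opnorm_nonneg)
      define K where "K = mat_opnorm ?D"
      have K: "l2_bounded ?D K" "0 \<le> K" "K < 1"
        using nonneg small l2_bounded_mat_opnorm[of ?D] by (simp_all add: K_def)
      have "l2_bounded (block_diag ?R ?r (\<mu> i j l k) off ?b) K"
        using K(1) by (simp only: D)
      moreover have "?b m' \<in> carrier_mat ?r ?r" if "m' < \<mu> i j l k" for m'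
        using c[OF that yz(2)] by (rule minus_carrier_mat)
      ultimately have "l2_bounded (?b m) K"
        using l2_bounded_block[OF off(1), of ?b K m] K(2) m by blast
      moreover have "?b m *\<^sub>v w = complex_of_real (g l U (?L y)) \<cdot>\<^sub>v w"
      proof -
        have p: "proj (A i) l (?L y) \<in> carrier_mat ?r ?r" "proj (A i) l (?L z) \<in> carrier_mat ?r ?r"
          using homog_sumD(6)[OF A l] L yz by auto
        have "g l U (?L z) = 0"
          using Q[OF l] notin L[OF yz(2)] by (auto simp: Q_def)
        then have "?b m = complex_of_real (g l U (?L y)) \<cdot>\<^sub>m proj (A i) l (?L y)"
          using p L yz by (intro eq_matI) (auto simp: scaled_proj_def)
        moreover have "complex_of_real (g l U (?L y)) \<cdot>\<^sub>m proj (A i) l (?L y) *\<^sub>v w =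
            complex_of_real (g l U (?L y)) \<cdot>\<^sub>v (proj (A i) l (?L y) *\<^sub>v w)"
          using p w(1) by (intro eq_vecI) (auto simp: scalar_prod_def sum_distrib_left mult_ac)
        ultimately show ?thesis
          using w(2) by simp
      qed
      moreover have "w \<in> carrier_vec (dim_col (?b m))"
        using carrier_matD(2)[OF c[OF m yz(2)]] w(1) by simp
      ultimately have "vec_l2norm (complex_of_real (g l U (?L y)) \<cdot>\<^sub>v w) \<le> K * vec_l2norm w"
        unfolding l2_bounded_def by metis
      then have "g l U (?L y) * vec_l2norm w \<le> K * vec_l2norm w"
        using y by (simp add: vec_l2norm_smult)
      then show False
        using w(3) y K(3) by simp
    qed
    show "refines \<beta> (pullback_cover ?Y ?L (?C l))"
      unfolding refines_def
    proof
      fix V assume V: "V \<in> \<beta>"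
      then have VY: "V \<subseteq> topspace ?Y"
        using \<beta> by (auto simp: variation_covers_def fin_open_cover_def)
      \<comment> \<open>An empty \<open>V\<close> lies in any member; an arbitrary point serves to pick one.\<close>
      obtain y where y: "y \<in> topspace ?Y" "V \<noteq> {} \<Longrightarrow> y \<in> V"
        using VY homog_sumD(1)[OF A k] by blast
      obtain U where U: "U \<in> ?C l" "1 \<le> g l U (?L y)"
        using Q[OF l] L[OF y(1)] by (auto simp: Q_def)
      have "V \<subseteq> {z \<in> topspace ?Y. ?L z \<in> U}"
        using key[OF U(1) V y(2) _ U(2)] VY by blast
      then show "\<exists>W\<in>pullback_cover ?Y ?L (?C l). V \<subseteq> W"
        using U(1) by (auto simp: pullback_cover_def)
    qed
  qed
  ultimately show ?thesis
    using that by blast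
qed

definition variation_ratio ::
    "(nat \<Rightarrow> 'a homog_sum) \<Rightarrow> (nat \<Rightarrow> 'a elem \<Rightarrow> 'a elem) \<Rightarrow> nat \<Rightarrow> 'a elem set \<Rightarrow> real \<Rightarrow> nat \<Rightarrow> real" where
  "variation_ratio A \<phi> i F \<epsilon> j = (MAX k\<in>{..<num (A j)}.
     real (variation_dim (base (A j) k) ((\<lambda>f. conn \<phi> i j f k) ` F) \<epsilon>) / real (prank (A j) k))"

lemma variation_ratio_le_dim_ratio:
  assumes AH: "AH_diagonal A \<phi> \<mu> \<Lambda>" and F: "finite F" "F \<subseteq> alg (A i)" and "0 < \<epsilon>"
  obtains \<alpha> where "\<alpha> \<in> component_covers (A i)"
    "\<And>j. i < j \<Longrightarrow> variation_ratio A \<phi> i F \<epsilon> j \<le> dim_ratio A \<mu> \<Lambda> i \<alpha> j"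
proof -
  obtain \<alpha> where \<alpha>: "\<alpha> \<in> component_covers (A i)"
    "\<And>j k \<beta>. i < j \<Longrightarrow> k < num (A j) \<Longrightarrow> fin_open_cover (base (A j) k) \<beta> \<Longrightarrow>
      refines \<beta> (transported_cover A \<mu> \<Lambda> i j k \<alpha>) \<Longrightarrow>
      \<beta> \<in> variation_covers (base (A j) k) ((\<lambda>f. conn \<phi> i j f k) ` F) \<epsilon>"
    using transported_refinements_in_variation_covers[OF AH F \<open>0 < \<epsilon>\<close>] by metis
  have "variation_ratio A \<phi> i F \<epsilon> j \<le> dim_ratio A \<mu> \<Lambda> i \<alpha> j" if j: "i < j" for j
    unfolding variation_ratio_def dim_ratio_def
  proof (rule Max_image_mono)
    show "{..<num (A j)} \<noteq> {}"
      using AH_diagonalD(1)[OF AH, of j] by (auto simp: homog_sum_def)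
    fix k assume "k \<in> {..<num (A j)}"
    then have k: "k < num (A j)"
      by simp
    obtain \<beta> where "fin_open_cover (base (A j) k) \<beta>" "refines \<beta> (transported_cover A \<mu> \<Lambda> i j k \<alpha>)"
        "cover_ord (base (A j) k) \<beta> = cover_dim (base (A j) k) (transported_cover A \<mu> \<Lambda> i j k \<alpha>)"
      using cover_dim_attained[OF fin_open_cover_transported[OF AH j k \<alpha>(1)]] .
    then have "variation_dim (base (A j) k) ((\<lambda>f. conn \<phi> i j f k) ` F) \<epsilon> \<le>
        cover_dim (base (A j) k) (transported_cover A \<mu> \<Lambda> i j k \<alpha>)"
      using variation_dim_le[OF \<alpha>(2)[OF j k]] by metis
    then show "real (variation_dim (base (A j) k) ((\<lambda>f. conn \<phi> i j f k) ` F) \<epsilon>) / real (prank (A j) k) \<le>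
        real (cover_dim (base (A j) k) (transported_cover A \<mu> \<Lambda> i j k \<alpha>)) / real (prank (A j) k)"
      by (intro divide_right_mono) auto
  qed simp
  then show ?thesis
    using that \<alpha>(1) by blast
qed

lemma dim_ratio_le_variation_ratio:
  assumes AH: "AH_diagonal A \<phi> \<mu> \<Lambda>" and \<alpha>: "\<alpha> \<in> component_covers (A i)"
  obtains F where "finite F" "F \<subseteq> alg (A i)"
    "\<And>j. i < j \<Longrightarrow> dim_ratio A \<mu> \<Lambda> i \<alpha> j \<le> variation_ratio A \<phi> i F 1 j"
proof -
  obtain F where F: "finite F" "F \<subseteq> alg (A i)"
    "\<And>j k \<beta>. i < j \<Longrightarrow> k < num (A j) \<Longrightarrow>
      \<beta> \<in> variation_covers (base (A j) k) ((\<lambda>f. conn \<phi> i j f k) ` F) 1 \<Longrightarrow>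
      refines \<beta> (transported_cover A \<mu> \<Lambda> i j k \<alpha>)"
    using variation_covers_refine_transported[OF AH \<alpha>] by metis
  obtain \<alpha>' where \<alpha>': "\<alpha>' \<in> component_covers (A i)"
    "\<And>j k \<beta>. i < j \<Longrightarrow> k < num (A j) \<Longrightarrow> fin_open_cover (base (A j) k) \<beta> \<Longrightarrow>
      refines \<beta> (transported_cover A \<mu> \<Lambda> i j k \<alpha>') \<Longrightarrow>
      \<beta> \<in> variation_covers (base (A j) k) ((\<lambda>f. conn \<phi> i j f k) ` F) 1"
    using transported_refinements_in_variation_covers[OF AH F(1,2), of 1] by auto
  have "dim_ratio A \<mu> \<Lambda> i \<alpha> j \<le> variation_ratio A \<phi> i F 1 j" if j: "i < j" for j
    unfolding variation_ratio_def dim_ratio_def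
  proof (rule Max_image_mono)
    show "{..<num (A j)} \<noteq> {}"
      using AH_diagonalD(1)[OF AH, of j] by (auto simp: homog_sum_def)
    fix k assume "k \<in> {..<num (A j)}"
    then have k: "k < num (A j)"
      by simp
    let ?V = "variation_covers (base (A j) k) ((\<lambda>f. conn \<phi> i j f k) ` F) 1"
    have "transported_cover A \<mu> \<Lambda> i j k \<alpha>' \<in> ?V"
      using \<alpha>'(2)[OF j k fin_open_cover_transported[OF AH j k \<alpha>'(1)]] by (auto simp: refines_def)
    then have "?V \<noteq> {}"
      by blast
    then obtain \<beta> where \<beta>: "\<beta> \<in> ?V"
        "cover_ord (base (A j) k) \<beta> = variation_dim (base (A j) k) ((\<lambda>f. conn \<phi> i j f k) ` F) 1"
      by (rule variation_dim_attained)
    then have "fin_open_cover (base (A j) k) \<beta>"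
      by (simp add: variation_covers_def)
    then have "cover_dim (base (A j) k) (transported_cover A \<mu> \<Lambda> i j k \<alpha>) \<le>
        variation_dim (base (A j) k) ((\<lambda>f. conn \<phi> i j f k) ` F) 1"
      unfolding \<beta>(2)[symmetric] by (rule cover_dim_le[OF _ F(3)[OF j k \<beta>(1)]])
    then show "real (cover_dim (base (A j) k) (transported_cover A \<mu> \<Lambda> i j k \<alpha>)) / real (prank (A j) k) \<le>
        real (variation_dim (base (A j) k) ((\<lambda>f. conn \<phi> i j f k) ` F) 1) / real (prank (A j) k)"
      by (intro divide_right_mono) auto
  qed simp
  then show ?thesis
    using that F(1,2) by blast
qed

lemma mean_dim_at_eq_var_mean_dim_at:
  assumes AH: "AH_diagonal A \<phi> \<mu> \<Lambda>"
  shows "mean_dim_at A \<mu> \<Lambda> i = var_mean_dim_at A \<phi> i"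
proof -
  let ?a = "\<lambda>\<alpha> j. ereal (dim_ratio A \<mu> \<Lambda> i \<alpha> j)" and ?b = "\<lambda>F \<epsilon> j. ereal (variation_ratio A \<phi> i F \<epsilon> j)"
  let ?P = "{(F, \<epsilon>). finite F \<and> F \<subseteq> alg (A i) \<and> (0::real) < \<epsilon>}"
  have lim: "lim (?a \<alpha>) = liminf (?a \<alpha>)" if "\<alpha> \<in> component_covers (A i)" for \<alpha>
    using dim_ratio_tendsto_lim[OF AH that] by (intro lim_imp_Liminf[symmetric]) auto
  have ev: "eventually (\<lambda>j. i < j) sequentially"
    by (rule eventually_gt_at_top)
  have "(SUP \<alpha>\<in>component_covers (A i). lim (?a \<alpha>)) = (SUP (F, \<epsilon>)\<in>?P. liminf (?b F \<epsilon>))"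
  proof (rule antisym)
    show "(SUP \<alpha>\<in>component_covers (A i). lim (?a \<alpha>)) \<le> (SUP (F, \<epsilon>)\<in>?P. liminf (?b F \<epsilon>))"
    proof (rule SUP_least)
      fix \<alpha> assume \<alpha>: "\<alpha> \<in> component_covers (A i)"
      obtain F where F: "finite F" "F \<subseteq> alg (A i)"
          "\<And>j. i < j \<Longrightarrow> dim_ratio A \<mu> \<Lambda> i \<alpha> j \<le> variation_ratio A \<phi> i F 1 j"
        using dim_ratio_le_variation_ratio[OF AH \<alpha>] by metis
      have "liminf (?a \<alpha>) \<le> liminf (?b F 1)"
        using F(3) by (intro Liminf_mono eventually_mono[OF ev]) simp
      then show "lim (?a \<alpha>) \<le> (SUP (F, \<epsilon>)\<in>?P. liminf (?b F \<epsilon>))"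
        using F(1,2) lim[OF \<alpha>] by (intro SUP_upper2[of "(F, 1)"]) auto
    qed
    show "(SUP (F, \<epsilon>)\<in>?P. liminf (?b F \<epsilon>)) \<le> (SUP \<alpha>\<in>component_covers (A i). lim (?a \<alpha>))"
    proof (rule SUP_least, clarsimp)
      fix F and \<epsilon> :: real assume F: "finite F" "F \<subseteq> alg (A i)" "0 < \<epsilon>"
      obtain \<alpha> where \<alpha>: "\<alpha> \<in> component_covers (A i)"
          "\<And>j. i < j \<Longrightarrow> variation_ratio A \<phi> i F \<epsilon> j \<le> dim_ratio A \<mu> \<Lambda> i \<alpha> j"
        using variation_ratio_le_dim_ratio[OF AH F] by metis
      have "liminf (?b F \<epsilon>) \<le> liminf (?a \<alpha>)"
        using \<alpha>(2) by (intro Liminf_mono eventually_mono[OF ev]) simp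
      then show "liminf (?b F \<epsilon>) \<le> (SUP \<alpha>\<in>component_covers (A i). lim (?a \<alpha>))"
        using lim[OF \<alpha>(1)] by (intro SUP_upper2[OF \<alpha>(1)]) simp
    qed
  qed
  then show ?thesis
    by (simp only: mean_dim_at_def var_mean_dim_at_def dim_ratio_def variation_ratio_def)
qed

theorem lemma8p2:
  fixes A :: "nat \<Rightarrow> 'a homog_sum"
    and \<phi> :: "nat \<Rightarrow> 'a elem \<Rightarrow> 'a elem"
    and \<mu> :: "nat \<Rightarrow> nat \<Rightarrow> nat \<Rightarrow> nat \<Rightarrow> nat"
    and \<Lambda> :: "nat \<Rightarrow> nat \<Rightarrow> nat \<Rightarrow> nat \<Rightarrow> nat \<Rightarrow> 'a \<Rightarrow> 'a"
  assumes "AH_diagonal A \<phi> \<mu> \<Lambda>"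
  shows "mean_dim A \<mu> \<Lambda> = var_mean_dim A \<phi>"
proof -
  have "mean_dim_at A \<mu> \<Lambda> = var_mean_dim_at A \<phi>"
    using mean_dim_at_eq_var_mean_dim_at[OF assms] by (rule ext)
  then show ?thesis
    by (simp only: mean_dim_def var_mean_dim_def)
qed

end
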